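(* Let $R$ be a finite Frobenius ring and let $C\leq{}_RR^n$ be a modular two-weight code of index $r$ with nonzero homogeneous weights $w_1<w_2$ and with $C_0=\{\mathbf{0}\}$. Let $C'$ be the dual of the two-weight code $C$. Then the graph $\Gamma(C')$ is strongly regular with parameters $(N',K',\lambda',\mu')$ given by $$N'=|C|,\qquad K'=\frac{n}{r},\qquad \lambda'=\frac{2n-w_1-w_2}{r}+\frac{w_1w_2}{r^2|C|},\qquad \mu'=\frac{w_1w_2}{r^2|C|}.$$ Moreover, the graph $\Gamma(C')$ is trivial if and only if $w_1=n$ (i.e. if and only if $\Gamma(C)$ is trivial).
   Context: A finite ring $R$ (with $1$, unit group $R^\times$) is a Frobenius ring if there is a character $\chi\in\mathrm{Hom}_{\mathbb{Z}}(R,\mathbb{C}^\times)$ of $(R,+)$ whose kernel contains no nonzero left (or right) ideal of $R$. The (normalized) homogeneous weight is $w_{\mathrm{hom}}(x)=1-\frac{1}{|R^\times|}\sum_{u\in R^\times}\chi(ux)$ for $x\in R$ (independent of the choice of $\chi$; it takes real values $\ge 0$), extended to $R^n$ by $w_{\mathrm{hom}}(\mathbf{x})=\sum_{j=1}^n w_{\mathrm{hom}}(x_j)$. A (left) linear code $C\leq{}_RR^n$ is a submodule of the left module ${}_RR^n$; a right linear code is a submodule of the right module $R^m_R$. Points of the projective geometry $\mathrm{PG}(R^k_R)$ are the nonzero cyclic submodules $\mathbf{g}R$ of the free right module $R^k_R$ (column vectors). If $C$ is a left linear code with no all-zero coordinate and $C=\{\mathbf{x}\mathbf{G};\mathbf{x}\in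 R^k\}$ with $\mathbf{G}=(\mathbf{g}_1|\dots|\mathbf{g}_n)\in R^{k\times n}$, put $\alpha_C(\mathbf{g}R)=|\{j;1\le j\le n,\ \mathbf{g}_jR=\mathbf{g}R\}|$ for every point $\mathbf{g}R$. Such a code $C$ is modular of index $r$ if $r\in\mathbb{Q}$ and for every point $\mathbf{g}R$ either $\alpha_C(\mathbf{g}R)=0$ or $\alpha_C(\mathbf{g}R)=r\,|\mathbf{g}R^\times|$. (This does not depend on the choice of $k$ and $\mathbf{G}$.) A two-weight code is a (left or right) linear code $C$ whose codewords take exactly two distinct nonzero homogeneous weights $w_1<w_2$. Put $w_0=0$ and $C_i=\{\mathbf{c}\in C;w_{\mathrm{hom}}(\mathbf{c})=w_i\}$, $b_i=|C_i|$ for $i=0,1,2$. The set $C_0$ is a subgroup of $(C,+)$, and $C_1,C_2$ are unions of cosets of $C_0$. For a two-weight code $C$ (left or right linear), $\Gamma(C)$ is the graph whose vertices are the cosets of $C_0$ in $C$, with $\mathbf{c}+C_0$ and $\mathbf{d}+C_0$ adjacent iff $w_{\mathrm{hom}}(\mathbf{c}-\mathbf{d})=w_1$, the smaller of the two nonzero weights. Dual of a two-weight code: let $\mathbf{M}_1\in R^{b_1\times n}$ be a matrix whose rows are the codewords of $C$ of weight $w_1$, in some order. The dual $C'$ of $C$ is the right linear code $C'\leq R^{b_1}_R$ generated by the columns of $\mathbf{M}_1$. Under the hypotheses of the claim, $C'$ is a two-weight code with $C'_0=\{\mathbf{0}\}$ and nonzero weights $w_1'=\frac{(w_2-n-r)|C|}{w_2-w_1}<w_2'=\frac{(w_2-n)|C|}{w_2-w_1}$,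 so in $\Gamma(C')$ the vertices are the elements of $C'$ and two of them are adjacent iff their difference has homogeneous weight $w_1'$. A simple graph is strongly regular with parameters $(N,K,\lambda,\mu)$ if it has $N$ vertices, is regular of degree $K$, and any two adjacent (resp. distinct nonadjacent) vertices have exactly $\lambda$ (resp. $\mu$) common neighbours. A strongly regular graph is called trivial if it or its complement is a disjoint union of cliques of the same size (equivalently, $\mu=0$ resp. $\mu=K$). *)

theory Defs
  imports
    Complex_Main
    "HOL-Library.Disjoint_Sets"
    "Jordan_Normal_Form.Matrix"
    "Graph_Theory.Pair_Digraph"
begin

text \<open>The finite ring is a type of classes \<open>ring_1\<close> and \<open>finite\<close>; multiplication need not commute.\<close>

definition ring_units :: "'a::ring_1 set" where
  "ring_units = {u. \<exists>v. u * v = 1 \<and> v * u = 1}"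

definition left_ideal :: "'a::ring_1 set \<Rightarrow> bool" where
  "left_ideal I \<longleftrightarrow>
     0 \<in> I \<and> (\<forall>x\<in>I. \<forall>y\<in>I. x + y \<in> I) \<and> (\<forall>a. \<forall>x\<in>I. a * x \<in> I)"

definition right_ideal :: "'a::ring_1 set \<Rightarrow> bool" where
  "right_ideal I \<longleftrightarrow>
     0 \<in> I \<and> (\<forall>x\<in>I. \<forall>y\<in>I. x + y \<in> I) \<and> (\<forall>a. \<forall>x\<in>I. x * a \<in> I)"

definition additive_character :: "('a::ring_1 \<Rightarrow> complex) \<Rightarrow> bool" where
  "additive_character \<chi> \<longleftrightarrow> (\<forall>x. \<chi> x \<noteq> 0) \<and> (\<forall>x y. \<chi> (x + y) = \<chi> x * \<chi> y)"

text \<open>For a finite ring the left and the right version of the kernel condition are equivalent,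
  so either one is accepted.\<close>

definition generating_character :: "('a::ring_1 \<Rightarrow> complex) \<Rightarrow> bool" where
  "generating_character \<chi> \<longleftrightarrow> additive_character \<chi> \<and>
     ((\<forall>I. left_ideal I \<and> I \<subseteq> {x. \<chi> x = 1} \<longrightarrow> I = {0}) \<or>
      (\<forall>I. right_ideal I \<and> I \<subseteq> {x. \<chi> x = 1} \<longrightarrow> I = {0}))"

definition frobenius_ring :: "'a::{ring_1,finite} itself \<Rightarrow> bool" where
  "frobenius_ring _ \<longleftrightarrow> (\<exists>\<chi>::'a \<Rightarrow> complex. generating_character \<chi>)"

text \<open>The weight does not depend on the generating character that is chosen. The character sum is
  real, because \<open>-1\<close> is a unit and \<open>\<chi> (- x)\<close> is the conjugate of \<open>\<chi> x\<close>; hence \<open>Re\<close> loses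
  nothing.\<close>

definition hom_weight :: "'a::{ring_1,finite} \<Rightarrow> real" where
  "hom_weight x =
     (let \<chi> = (SOME \<chi>::'a \<Rightarrow> complex. generating_character \<chi>)
      in 1 - Re (\<Sum>u\<in>ring_units. \<chi> (u * x)) / real (card (ring_units :: 'a set)))"

definition hom_weight_vec :: "'a::{ring_1,finite} vec \<Rightarrow> real" where
  "hom_weight_vec x = (\<Sum>j<dim_vec x. hom_weight (x $ j))"

definition right_smult_vec :: "'a::ring_1 vec \<Rightarrow> 'a \<Rightarrow> 'a vec" where
  "right_smult_vec x a = vec (dim_vec x) (\<lambda>i. x $ i * a)"

definition vec_mult_mat :: "'a::ring_1 vec \<Rightarrow> 'a mat \<Rightarrow> 'a vec" where
  "vec_mult_mat x G = vec (dim_col G) (\<lambda>j. x \<bullet> col G j)"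

definition left_linear_code :: "nat \<Rightarrow> 'a::ring_1 vec set \<Rightarrow> bool" where
  "left_linear_code n C \<longleftrightarrow> C \<subseteq> carrier_vec n \<and> 0\<^sub>v n \<in> C \<and>
     (\<forall>x\<in>C. \<forall>y\<in>C. x + y \<in> C) \<and> (\<forall>a. \<forall>x\<in>C. a \<cdot>\<^sub>v x \<in> C)"

definition right_linear_code :: "nat \<Rightarrow> 'a::ring_1 vec set \<Rightarrow> bool" where
  "right_linear_code m C \<longleftrightarrow> C \<subseteq> carrier_vec m \<and> 0\<^sub>v m \<in> C \<and>
     (\<forall>x\<in>C. \<forall>y\<in>C. x + y \<in> C) \<and> (\<forall>a. \<forall>x\<in>C. right_smult_vec x a \<in> C)"

definition right_span :: "nat \<Rightarrow> 'a::ring_1 vec set \<Rightarrow> 'a vec set" where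
  "right_span m S = \<Inter>{D. right_linear_code m D \<and> S \<subseteq> D}"

definition cyclic_right_submodule :: "'a::ring_1 vec \<Rightarrow> 'a vec set" where
  "cyclic_right_submodule g = range (right_smult_vec g)"

definition point_multiplicity :: "'a::ring_1 mat \<Rightarrow> 'a vec set \<Rightarrow> nat" where
  "point_multiplicity G P = card {j. j < dim_col G \<and> cyclic_right_submodule (col G j) = P}"

text \<open>Points are given by nonzero representatives \<open>g\<close>. The condition does not depend on the
  generator matrix, so asking for one such matrix is the same as asking for all of them.\<close>

definition modular_code :: "nat \<Rightarrow> 'a::{ring_1,finite} vec set \<Rightarrow> real \<Rightarrow> bool" where
  "modular_code n C r \<longleftrightarrow>
     left_linear_code n C \<and> (\<forall>j<n. \<exists>c\<in>C. c $ j \<noteq> 0) \<and> r \<in> \<rat> \<and>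
     (\<exists>k. \<exists>G\<in>carrier_mat k n.
        C = {vec_mult_mat x G | x. x \<in> carrier_vec k} \<and>
        (\<forall>g\<in>carrier_vec k. g \<noteq> 0\<^sub>v k \<longrightarrow>
           point_multiplicity G (cyclic_right_submodule g) = 0 \<or>
           real (point_multiplicity G (cyclic_right_submodule g)) =
             r * real (card (right_smult_vec g ` ring_units))))"

definition words_of_weight :: "'a::{ring_1,finite} vec set \<Rightarrow> real \<Rightarrow> 'a vec set" where
  "words_of_weight C w = {c \<in> C. hom_weight_vec c = w}"

definition nonzero_weights :: "'a::{ring_1,finite} vec set \<Rightarrow> real set" where
  "nonzero_weights C = hom_weight_vec ` C - {0}"

definition two_weight_code ::
  "nat \<Rightarrow> 'a::{ring_1,finite} vec set \<Rightarrow> real \<Rightarrow> real \<Rightarrow> bool" where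
  "two_weight_code n C w1 w2 \<longleftrightarrow> (left_linear_code n C \<or> right_linear_code n C) \<and>
     w1 < w2 \<and> nonzero_weights C = {w1, w2}"

definition smaller_weight :: "'a::{ring_1,finite} vec set \<Rightarrow> real" where
  "smaller_weight C = Min (nonzero_weights C)"

definition zero_coset :: "'a::{ring_1,finite} vec set \<Rightarrow> 'a vec \<Rightarrow> 'a vec set" where
  "zero_coset C c = {c + z | z. z \<in> words_of_weight C 0}"

definition code_graph :: "'a::{ring_1,finite} vec set \<Rightarrow> 'a vec set pair_pre_digraph" where
  "code_graph C =
     \<lparr>pverts = zero_coset C ` C,
      parcs = {(zero_coset C c, zero_coset C d) | c d.
                 c \<in> C \<and> d \<in> C \<and> hom_weight_vec (c - d) = smaller_weight C}\<rparr>"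

text \<open>The dual depends on the order of the rows of the matrix, and is therefore a relation. It is a
  code of length \<open>card (words_of_weight C (smaller_weight C))\<close>.\<close>

definition is_dual_code ::
  "nat \<Rightarrow> 'a::{ring_1,finite} vec set \<Rightarrow> 'a vec set \<Rightarrow> bool" where
  "is_dual_code n C C' \<longleftrightarrow>
     (let C1 = words_of_weight C (smaller_weight C); b1 = card C1
      in \<exists>M\<in>carrier_mat b1 n. bij_betw (row M) {..<b1} C1 \<and> C' = right_span b1 (set (cols M)))"

definition common_neighbours :: "'v pair_pre_digraph \<Rightarrow> 'v \<Rightarrow> 'v \<Rightarrow> 'v set" where
  "common_neighbours \<Gamma> x y = {z \<in> pverts \<Gamma>. (x, z) \<in> parcs \<Gamma> \<and> (y, z) \<in> parcs \<Gamma>}"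

definition strongly_regular ::
  "'v pair_pre_digraph \<Rightarrow> nat \<Rightarrow> nat \<Rightarrow> nat \<Rightarrow> nat \<Rightarrow> bool" where
  "strongly_regular \<Gamma> N K l m \<longleftrightarrow> pair_graph \<Gamma> \<and> card (pverts \<Gamma>) = N \<and>
     (\<forall>x\<in>pverts \<Gamma>. card {y \<in> pverts \<Gamma>. (x, y) \<in> parcs \<Gamma>} = K) \<and>
     (\<forall>x\<in>pverts \<Gamma>. \<forall>y\<in>pverts \<Gamma>. (x, y) \<in> parcs \<Gamma> \<longrightarrow>
        card (common_neighbours \<Gamma> x y) = l) \<and>
     (\<forall>x\<in>pverts \<Gamma>. \<forall>y\<in>pverts \<Gamma>. x \<noteq> y \<and> (x, y) \<notin> parcs \<Gamma> \<longrightarrow>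
        card (common_neighbours \<Gamma> x y) = m)"

definition complement_graph :: "'v pair_pre_digraph \<Rightarrow> 'v pair_pre_digraph" where
  "complement_graph \<Gamma> =
     \<lparr>pverts = pverts \<Gamma>,
      parcs = {(x, y). x \<in> pverts \<Gamma> \<and> y \<in> pverts \<Gamma> \<and> x \<noteq> y \<and> (x, y) \<notin> parcs \<Gamma>}\<rparr>"

definition union_of_equal_cliques :: "'v pair_pre_digraph \<Rightarrow> bool" where
  "union_of_equal_cliques \<Gamma> \<longleftrightarrow>
     (\<exists>\<P> s. partition_on (pverts \<Gamma>) \<P> \<and> (\<forall>Q\<in>\<P>. card Q = s) \<and>
        parcs \<Gamma> = {(x, y). x \<noteq> y \<and> (\<exists>Q\<in>\<P>. x \<in> Q \<and> y \<in> Q)})"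

definition trivial_graph :: "'v pair_pre_digraph \<Rightarrow> bool" where
  "trivial_graph \<Gamma> \<longleftrightarrow>
     union_of_equal_cliques \<Gamma> \<or> union_of_equal_cliques (complement_graph \<Gamma>)"

end

theory Submission
  imports Defs
begin

text \<open>
  A generating character \<open>\<chi>\<close> identifies the dual code \<open>C'\<close> with the character group of \<open>C\<close>, the
  element \<open>M y\<close> of \<open>C'\<close> corresponding to \<open>c \<mapsto> \<chi> (c \<bullet> y)\<close>. By modularity the weight of a codeword
  \<open>c\<close> is \<open>n - r (\<Sum>\<psi>\<in>\<Psi>. \<psi> c)\<close> for a set \<open>\<Psi>\<close> of nontrivial characters of \<open>C\<close>. Hence the Cayley graph
  of the character group with connection set \<open>\<Psi>\<close> has the eigenvalues \<open>n / r\<close>, \<open>(n - w1) / r\<close> and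
  \<open>(n - w2) / r\<close>, the first one only for the trivial codeword, and so it is strongly regular.

  Inverting the Fourier transform gives the character sums over the codewords of weight \<open>w1\<close>, and
  these determine the weights in \<open>C'\<close>: the smaller nonzero weight is attained exactly on \<open>\<Psi>\<close>, so that
  the Cayley graph is \<open>\<Gamma>(C')\<close>. That this weight is not \<open>0\<close> follows from the fact that otherwise every
  \<open>\<psi> \<in> \<Psi>\<close> would be trivial on the words of weight \<open>w1\<close>, forcing \<open>w1 = 0\<close>. Since the parameter
  \<open>\<mu>\<close> is positive for both graphs, each of them is trivial if and only if one of its two
  nontrivial eigenvalues vanishes.
\<close>

section \<open>Characters of a finite ring\<close>

text \<open>Noncommutativity shapes the first half. The weight averages \<open>\<chi>\<close> over
  left unit multiples, whereas columns of a generator matrix are multiplied by units on the right;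
  \<open>sum_units_commute\<close> reconciles the two. Modularity counts columns that generate the
  same cyclic module, whereas the weight formula needs unit orbits;
  \<open>cyclic_generators_unit_multiple\<close> shows that the generators of a cyclic module form
  one orbit. The second half runs one argument, \<open>character_family\<close>, twice with the
  roles exchanged: for the group \<open>C\<close> with characters indexed by vectors of R^n, and for
  the group \<open>C'\<close> with characters indexed by codewords. That the words of weight
  \<open>w1\<close> alone determine the character of a vector, so that \<open>C'\<close> is as large
  as \<open>C\<close>, is not automatic: \<open>perp_iff\<close> deduces it from the positivity of
  the smaller dual weight. The triviality test comes from counting representations of zero: this
  gives K = \<mu> - \<theta>1 \<theta>2, so the condition \<mu> = K says that an eigenvalue
  vanishes.\<close>

lemma sum_eq_zero_by_shift:
  fixes f :: "'b \<Rightarrow> complex"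
  assumes "bij_betw t A A" and "\<And>x. x \<in> A \<Longrightarrow> f (t x) = z * f x" and "z \<noteq> 1"
  shows "sum f A = 0"
proof -
  have "sum f A = (\<Sum>x\<in>A. f (t x))"
    using sum.reindex_bij_betw[OF assms(1), of f] by simp
  also have "\<dots> = z * sum f A"
    using assms(2) by (simp add: sum_distrib_left)
  finally have "(1 - z) * sum f A = 0"
    by (simp add: algebra_simps)
  then show ?thesis using assms(3) by simp
qed

lemma additive_character_zero: "additive_character \<chi> \<Longrightarrow> \<chi> 0 = 1"
  unfolding additive_character_def by (metis add.right_neutral mult_cancel_left2)

text \<open>The largest modulus \<open>M\<close> is attained at some \<open>y\<close>, and the value
  at \<open>y + y\<close> has modulus \<open>M * M\<close>, so \<open>M \<le> 1\<close>. The values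
  at \<open>x\<close> and \<open>- x\<close> multiply to 1, which leaves only modulus 1 for
  both.\<close>

lemma norm_additive_character:
  fixes \<chi> :: "'a::{ring_1,finite} \<Rightarrow> complex"
  assumes "additive_character \<chi>"
  shows "cmod (\<chi> x) = 1"
proof -
  have mult: "\<chi> (x + y) = \<chi> x * \<chi> y" for x y
    using assms by (simp add: additive_character_def)
  have le: "cmod (\<chi> x) \<le> 1" for x
  proof -
    define M where "M = Max (range (\<lambda>x. cmod (\<chi> x)))"
    have M: "cmod (\<chi> y) \<le> M" for y
      unfolding M_def by (intro Max_ge) auto
    have "M \<in> range (\<lambda>x. cmod (\<chi> x))"
      unfolding M_def by (intro Max_in) auto
    then obtain y where y: "M = cmod (\<chi> y)" by auto
    have "M * M \<le> M * 1" using M[of "y + y"] by (simp add: mult norm_mult y)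
    moreover have "M > 0" using y assms by (simp add: additive_character_def)
    ultimately have "M \<le> 1" by (metis mult_le_cancel_left_pos)
    with M[of x] show ?thesis by simp
  qed
  have "cmod (\<chi> x) * cmod (\<chi> (- x)) = 1"
    using mult[of x "- x"] additive_character_zero[OF assms] by (metis add.right_inverse norm_mult norm_one)
  then show ?thesis
    using le[of x] le[of "- x"]
    by (metis mult_left_le nle_le norm_ge_zero)
qed

lemma additive_character_uminus:
  fixes \<chi> :: "'a::{ring_1,finite} \<Rightarrow> complex"
  assumes "additive_character \<chi>"
  shows "\<chi> (- x) = cnj (\<chi> x)"
proof -
  have "\<chi> x * \<chi> (- x) = 1"
    using assms additive_character_zero[OF assms]
    unfolding additive_character_def by (metis add.right_inverse)
  moreover have "\<chi> x * cnj (\<chi> x) = 1"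
    using norm_additive_character[OF assms, of x] by (simp add: complex_norm_square[symmetric])
  ultimately show ?thesis
    by (metis mult_cancel_left zero_neq_one mult_zero_left)
qed

lemma sum_additive_character:
  fixes \<psi> :: "'a::{ring_1,finite} \<Rightarrow> complex"
  assumes "additive_character \<psi>"
  shows "(\<Sum>x\<in>UNIV. \<psi> x) = (if \<forall>x. \<psi> x = 1 then of_nat (card (UNIV :: 'a set)) else 0)"
proof (cases "\<forall>x. \<psi> x = 1")
  case False
  then obtain z where z: "\<psi> z \<noteq> 1" by auto
  have "(\<Sum>x\<in>UNIV. \<psi> x) = 0"
  proof (rule sum_eq_zero_by_shift[OF _ _ z])
    show "bij_betw (\<lambda>x. z + x) UNIV UNIV"
      by (rule bij_plus)
    show "\<psi> (z + x) = \<psi> z * \<psi> x" for x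
      using assms by (simp add: additive_character_def)
  qed
  with False show ?thesis by simp
qed simp

lemma additive_character_mult_right:
  "additive_character \<chi> \<Longrightarrow> additive_character (\<lambda>x. \<chi> (x * b))"
  by (simp add: additive_character_def distrib_right)

lemma additive_character_mult_left:
  "additive_character \<chi> \<Longrightarrow> additive_character (\<lambda>x. \<chi> (a * x))"
  by (simp add: additive_character_def distrib_left)

text \<open>Summing \<open>\<chi> (a * b)\<close> over all pairs in both orders shows that the left and the right
  annihilator of the pairing \<open>(a, b) \<mapsto> \<chi> (a * b)\<close> have the same size.\<close>

lemma generating_character_nondegenerate:
  fixes \<chi> :: "'a::{ring_1,finite} \<Rightarrow> complex"
  assumes "generating_character \<chi>"
  shows "(\<forall>x. \<chi> (x * b) = 1) \<longleftrightarrow> b = 0" and "(\<forall>x. \<chi> (b * x) = 1) \<longleftrightarrow> b = 0"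
proof -
  define L where "L = {b. \<forall>x. \<chi> (x * b) = 1}"
  define R where "R = {a. \<forall>x. \<chi> (a * x) = 1}"
  have \<chi>: "additive_character \<chi>" using assms by (simp add: generating_character_def)
  have mult: "\<chi> (x + y) = \<chi> x * \<chi> y" for x y
    using \<chi> by (simp add: additive_character_def)
  have zero: "0 \<in> L" "0 \<in> R"
    using additive_character_zero[OF \<chi>] by (auto simp: L_def R_def)
  have "(\<Sum>b\<in>UNIV. \<Sum>a\<in>UNIV. \<chi> (a * b)) = (\<Sum>b\<in>UNIV. if b \<in> L then of_nat (card (UNIV :: 'a set)) else 0)"
    by (simp add: sum_additive_character[OF additive_character_mult_right[OF \<chi>]] L_def)
  moreover have "(\<Sum>a\<in>UNIV. \<Sum>b\<in>UNIV. \<chi> (a * b)) = (\<Sum>b\<in>UNIV. if b \<in> R then of_nat (card (UNIV :: 'a set)) else 0)"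
    by (simp add: sum_additive_character[OF additive_character_mult_left[OF \<chi>]] R_def)
  moreover have "(\<Sum>b\<in>UNIV. \<Sum>a\<in>UNIV. \<chi> (a * b)) = (\<Sum>a\<in>UNIV. \<Sum>b\<in>UNIV. \<chi> (a * b))"
    by (rule sum.swap)
  ultimately have "of_nat (card L * card (UNIV :: 'a set)) = (of_nat (card R * card (UNIV :: 'a set)) :: complex)"
    by (simp add: sum.If_cases)
  then have card: "card L = card R"
    by (simp only: of_nat_eq_iff) simp
  have "left_ideal L" "L \<subseteq> {x. \<chi> x = 1}"
    unfolding left_ideal_def L_def
    by (auto simp: additive_character_zero[OF \<chi>] distrib_left mult mult.assoc[symmetric] dest: spec[of _ 1])
  moreover have "right_ideal R" "R \<subseteq> {x. \<chi> x = 1}"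
    unfolding right_ideal_def R_def
    by (auto simp: additive_character_zero[OF \<chi>] distrib_right mult mult.assoc dest: spec[of _ 1])
  ultimately have "L = {0} \<or> R = {0}"
    using assms unfolding generating_character_def by blast
  then have "card L = 1" "card R = 1" using card by auto
  then have "L = {0}" "R = {0}" using zero by (auto simp: card_1_singleton_iff)
  then show "(\<forall>x. \<chi> (x * b) = 1) \<longleftrightarrow> b = 0" "(\<forall>x. \<chi> (b * x) = 1) \<longleftrightarrow> b = 0"
    by (auto simp: L_def R_def)
qed

text \<open>The correlations of the given character with all left twists, summed over
  \<open>v\<close>, collapse by nondegeneracy to the term \<open>x = 0\<close>, which is the order
  of the ring. Hence some correlation is nonzero, and two characters with nonzero correlation
  agree.\<close>

lemma generating_character_left_twist:
  fixes \<chi> :: "'a::{ring_1,finite} \<Rightarrow> complex"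
  assumes "generating_character \<chi>"
  shows "\<exists>v. \<forall>x. \<chi> (x * a) = \<chi> (v * x)"
proof -
  have \<chi>: "additive_character \<chi>" using assms by (simp add: generating_character_def)
  have mult: "\<chi> (x + y) = \<chi> x * \<chi> y" for x y
    using \<chi> by (simp add: additive_character_def)
  have "(\<Sum>v\<in>UNIV. \<Sum>x\<in>UNIV. \<chi> (x * a - v * x)) = (\<Sum>x\<in>UNIV. \<chi> (x * a) * (\<Sum>v\<in>UNIV. \<chi> (v * (- x))))"
    by (subst sum.swap) (simp add: sum_distrib_left mult[symmetric])
  also have "\<dots> = (\<Sum>x\<in>(UNIV::'a set). if x = 0 then of_nat (card (UNIV :: 'a set)) else 0)"
  proof (intro sum.cong refl)
    fix x
    show "\<chi> (x * a) * (\<Sum>v\<in>UNIV. \<chi> (v * - x)) = (if x = 0 then of_nat (card (UNIV :: 'a set)) else 0)"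
      using sum_additive_character[OF additive_character_mult_right[OF \<chi>, of "- x"]]
        generating_character_nondegenerate(1)[OF assms, of "- x"]
      by (auto simp: additive_character_zero[OF \<chi>])
  qed
  also have "\<dots> \<noteq> 0" by simp
  finally obtain v where v: "(\<Sum>x\<in>UNIV. \<chi> (x * a - v * x)) \<noteq> 0"
    by (meson sum.neutral)
  have "additive_character (\<lambda>x. \<chi> (x * a - v * x))"
    using \<chi> by (auto simp: additive_character_def distrib_right distrib_left mult[symmetric] algebra_simps)
  from sum_additive_character[OF this] v have "\<chi> (x * a - v * x) = 1" for x
    by (metis (no_types, lifting))
  then have "\<chi> (x * a) = \<chi> (v * x)" for x
    using mult[of "x * a - v * x" "v * x"] by simp
  then show ?thesis by auto
qed

lemma bij_betw_mult_right_units: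
  assumes "u \<in> (ring_units :: 'a::ring_1 set)"
  shows "bij_betw (\<lambda>v. v * u) ring_units ring_units"
proof -
  obtain w where w: "u * w = 1" "w * u = 1" using assms by (auto simp: ring_units_def)
  have "v * u \<in> ring_units" if v: "v \<in> ring_units" and uw: "u * w = 1" "w * u = 1" for v u w :: 'a
  proof -
    obtain z where z: "v * z = 1" "z * v = 1" using v by (auto simp: ring_units_def)
    have "v * u * (w * z) = v * (u * w) * z" "w * z * (v * u) = w * (z * v) * u"
      by (simp_all add: mult.assoc)
    then show ?thesis using z uw by (auto simp: ring_units_def)
  qed
  then show ?thesis
    using w by (intro bij_betwI[where g = "\<lambda>v. v * w"]) (auto simp: mult.assoc)
qed

lemma uminus_ring_units: "- u \<in> ring_units \<longleftrightarrow> u \<in> (ring_units :: 'a::ring_1 set)"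
proof -
  have "- u \<in> ring_units" if u: "u \<in> ring_units" for u :: 'a
  proof -
    obtain v where "u * v = 1" "v * u = 1" using u by (auto simp: ring_units_def)
    then have "- u * - v = 1" "- v * - u = 1" by simp_all
    then show ?thesis unfolding ring_units_def by blast
  qed
  from this[of u] this[of "- u"] show ?thesis by auto
qed

lemma one_ring_units: "1 \<in> ring_units"
  by (auto simp: ring_units_def)

text \<open>The twist \<open>\<tau>\<close> with \<open>\<chi> (x * a) = \<chi> (\<tau> a * x)\<close> is an automorphism of the ring (the Nakayama
  automorphism), hence permutes the units.\<close>

lemma sum_units_commute:
  fixes \<chi> :: "'a::{ring_1,finite} \<Rightarrow> complex"
  assumes "generating_character \<chi>"
  shows "(\<Sum>u\<in>ring_units. \<chi> (u * t)) = (\<Sum>u\<in>ring_units. \<chi> (t * u))"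
proof -
  have \<chi>: "additive_character \<chi>" using assms by (simp add: generating_character_def)
  have mult: "\<chi> (x + y) = \<chi> x * \<chi> y" for x y
    using \<chi> by (simp add: additive_character_def)
  have nz: "\<chi> x \<noteq> 0" for x using \<chi> by (simp add: additive_character_def)
  obtain \<tau> where \<tau>: "\<chi> (x * a) = \<chi> (\<tau> a * x)" for a x
    using generating_character_left_twist[OF assms] by metis
  \<comment> \<open>Uniqueness of the multiplier is what makes the arbitrarily chosen
    \<open>\<tau>\<close> multiplicative.\<close>
  have unique: "a = b" if "\<And>x. \<chi> (a * x) = \<chi> (b * x)" for a b
  proof -
    have "\<chi> ((a - b) * x) = 1" for x
      using mult[of "(a - b) * x" "b * x"] that[of x] nz[of "b * x"] by (simp add: left_diff_distrib)
    then show ?thesis using generating_character_nondegenerate(2)[OF assms, of "a - b"] by simp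
  qed
  have unique': "a = b" if "\<And>x. \<chi> (x * a) = \<chi> (x * b)" for a b
  proof -
    have "\<chi> (x * (a - b)) = 1" for x
      using mult[of "x * (a - b)" "x * b"] that[of x] nz[of "x * b"] by (simp add: right_diff_distrib)
    then show ?thesis using generating_character_nondegenerate(1)[OF assms, of "a - b"] by simp
  qed
  have \<tau>_mult: "\<tau> (a * b) = \<tau> a * \<tau> b" for a b
  proof (rule unique)
    fix x
    have "\<chi> (\<tau> (a * b) * x) = \<chi> (x * a * b)"
      using \<tau>[of x "a * b"] by (simp add: mult.assoc)
    also have "\<dots> = \<chi> (\<tau> b * x * a)"
      using \<tau>[of "x * a" b] by (simp add: mult.assoc)
    also have "\<dots> = \<chi> (\<tau> a * \<tau> b * x)"
      using \<tau>[of "\<tau> b * x" a] by (simp add: mult.assoc)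
    finally show "\<chi> (\<tau> (a * b) * x) = \<chi> (\<tau> a * \<tau> b * x)" .
  qed
  have \<tau>_one: "\<tau> 1 = 1"
    using \<tau>[of _ 1] by (intro unique) simp
  have inj: "inj \<tau>"
  proof (rule injI, rule unique')
    fix a b x assume "\<tau> a = \<tau> b"
    then show "\<chi> (x * a) = \<chi> (x * b)" using \<tau>[of x a] \<tau>[of x b] by simp
  qed
  have "\<tau> u \<in> ring_units" if u: "u \<in> ring_units" for u
  proof -
    obtain v where "u * v = 1" "v * u = 1" using u by (auto simp: ring_units_def)
    then have "\<tau> u * \<tau> v = 1" "\<tau> v * \<tau> u = 1" by (simp_all only: \<tau>_mult[symmetric] \<tau>_one)
    then show ?thesis by (auto simp: ring_units_def)
  qed
  then have "bij_betw \<tau> ring_units ring_units"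
    using inj_on_subset[OF inj subset_UNIV] by (simp add: bij_betw_def endo_inj_surj image_subsetI)
  then have "(\<Sum>u\<in>ring_units. \<chi> (u * t)) = (\<Sum>u\<in>ring_units. \<chi> (\<tau> u * t))"
    by (rule sum.reindex_bij_betw[symmetric])
  also have "\<dots> = (\<Sum>u\<in>ring_units. \<chi> (t * u))"
    using \<tau>[of t] by (intro sum.cong refl) simp
  finally show ?thesis .
qed

section \<open>The homogeneous weight\<close>

text \<open>Names the character that \<open>hom_weight\<close> selects internally, so that weights
  and character sums refer to the same one.\<close>

definition gen_char :: "'a::{ring_1,finite} \<Rightarrow> complex" where
  "gen_char = (SOME \<chi>. generating_character \<chi>)"

context
  assumes frobenius: "frobenius_ring TYPE('a::{ring_1,finite})"
begin

lemma generating_gen_char: "generating_character (gen_char :: 'a \<Rightarrow> complex)"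
  using frobenius unfolding gen_char_def frobenius_ring_def by (metis someI_ex)

lemma additive_gen_char: "additive_character (gen_char :: 'a \<Rightarrow> complex)"
  using generating_gen_char by (simp add: generating_character_def)

lemma gen_char_add: "gen_char (x + y :: 'a) = gen_char x * gen_char y"
  using additive_gen_char by (simp add: additive_character_def)

lemma gen_char_zero: "gen_char (0::'a) = 1"
  by (rule additive_character_zero[OF additive_gen_char])

lemma gen_char_uminus: "gen_char (- x :: 'a) = cnj (gen_char x)"
  by (rule additive_character_uminus[OF additive_gen_char])

lemma norm_gen_char: "cmod (gen_char (x::'a)) = 1"
  by (rule norm_additive_character[OF additive_gen_char])

lemma card_ring_units_pos: "card (ring_units :: 'a set) > 0"
  using one_ring_units by (auto simp: card_gt_0_iff)

lemma hom_weight_eq: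
  "complex_of_real (hom_weight (x::'a)) =
     1 - (\<Sum>u\<in>ring_units. gen_char (u * x)) / of_nat (card (ring_units :: 'a set))"
proof -
  have "bij_betw uminus ring_units (ring_units :: 'a set)"
    by (intro bij_betwI[where g = uminus]) (auto simp: uminus_ring_units)
  from sum.reindex_bij_betw[OF this, of "\<lambda>u. gen_char (u * x)"]
  have "cnj (\<Sum>u\<in>ring_units. gen_char (u * x)) = (\<Sum>u\<in>ring_units. gen_char (u * x))"
    by (simp add: gen_char_uminus)
  then have "complex_of_real (Re (\<Sum>u\<in>ring_units. gen_char (u * x))) = (\<Sum>u\<in>ring_units. gen_char (u * x))"
    by (metis Reals_cnj_iff complex_is_Real_iff of_real_Re)
  then show ?thesis
    unfolding hom_weight_def Let_def gen_char_def[symmetric]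
    by (simp del: Re_sum)
qed

text \<open>For a coordinate \<open>x \<bullet> g\<close> of a codeword, a unit on the right can be
  absorbed into the column \<open>g\<close>; a unit on the left cannot.\<close>

lemma hom_weight_eq_right:
  "complex_of_real (hom_weight (x::'a)) =
     1 - (\<Sum>u\<in>ring_units. gen_char (x * u)) / of_nat (card (ring_units :: 'a set))"
  by (simp only: hom_weight_eq sum_units_commute[OF generating_gen_char])

lemma hom_weight_nonneg: "hom_weight (x::'a) \<ge> 0"
proof -
  have "Re (\<Sum>u\<in>ring_units. gen_char (u * x)) \<le> cmod (\<Sum>u\<in>ring_units. gen_char (u * x))"
    by (rule complex_Re_le_cmod)
  also have "\<dots> \<le> (\<Sum>u\<in>(ring_units::'a set). 1)"
    by (rule sum_norm_le) (simp add: norm_gen_char)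
  finally have "Re (\<Sum>u\<in>ring_units. gen_char (u * x)) \<le> real (card (ring_units :: 'a set))"
    by simp
  then show ?thesis
    unfolding hom_weight_def Let_def gen_char_def[symmetric]
    using card_ring_units_pos by (simp add: divide_le_eq)
qed

lemma hom_weight_zero: "hom_weight (0::'a) = 0"
  using one_ring_units
  unfolding hom_weight_def Let_def gen_char_def[symmetric]
  by (auto simp: gen_char_zero)

lemma hom_weight_unit_mult:
  assumes "v \<in> ring_units"
  shows "hom_weight (v * x :: 'a) = hom_weight x"
proof -
  from sum.reindex_bij_betw[OF bij_betw_mult_right_units[OF assms], of "\<lambda>u. gen_char (u * x)"]
  have "complex_of_real (hom_weight (v * x)) = complex_of_real (hom_weight x)"
    by (simp add: hom_weight_eq mult.assoc)
  then show ?thesis by simp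
qed

end

section \<open>Generators of a cyclic right module\<close>

text \<open>Let \<open>g R = h R\<close>. For every right ideal \<open>J\<close>, the fibres of \<open>b \<mapsto> g b\<close> over \<open>h\<close> and over \<open>g\<close>
  meet \<open>J\<close> in equally many elements, since both intersections are empty or cosets of the same group. By
  inclusion-exclusion over the right ideals, the two fibres then have equally many elements that
  generate \<open>R\<close> as a right ideal, that is, equally many units; and the fibre over \<open>g\<close> contains the
  unit \<open>1\<close>.\<close>

lemma card_generators_eq:
  fixes X Y :: "'a::{ring_1,finite} set"
  assumes "\<And>J. right_ideal J \<Longrightarrow> card (X \<inter> J) = card (Y \<inter> J)" and "right_ideal J"
  shows "card {b \<in> X. range ((*) b) = J} = card {b \<in> Y. range ((*) b) = J}"
  using assms(2)
proof (induction "card J" arbitrary: J rule: less_induct)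
  case less
  define \<J> where "\<J> = {J'. right_ideal J' \<and> J' \<subset> J}"
  have ideal: "right_ideal (range ((*) b))" for b :: 'a
    unfolding right_ideal_def
  proof (intro conjI ballI allI)
    show "0 \<in> range ((*) b)" by (rule range_eqI[of _ _ 0]) simp
    show "x + y \<in> range ((*) b)" if "x \<in> range ((*) b)" "y \<in> range ((*) b)" for x y
      using that by (auto simp: distrib_left[symmetric])
    show "x * a \<in> range ((*) b)" if "x \<in> range ((*) b)" for x a
      using that by (auto simp: mult.assoc)
  qed
  have mem: "b \<in> range ((*) b)" for b :: 'a
    by (rule range_eqI[of _ _ 1]) simp
  have sub: "range ((*) b) \<subseteq> J" if "b \<in> J" for b
    using that less.prems by (auto simp: right_ideal_def)
  \<comment> \<open>Elements are sorted by the right ideal that they generate; the induction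
    hypothesis handles the proper subideals of \<open>J\<close>.\<close>
  have count: "card (Z \<inter> J) = card {b \<in> Z. range ((*) b) = J} +
      (\<Sum>J'\<in>\<J>. card {b \<in> Z. range ((*) b) = J'})" for Z :: "'a set"
  proof -
    have "Z \<inter> J = {b \<in> Z. range ((*) b) = J} \<union> (\<Union>J'\<in>\<J>. {b \<in> Z. range ((*) b) = J'})"
      using sub mem ideal unfolding \<J>_def by blast
    moreover have "card (\<Union>J'\<in>\<J>. {b \<in> Z. range ((*) b) = J'}) =
        (\<Sum>J'\<in>\<J>. card {b \<in> Z. range ((*) b) = J'})"
      by (rule card_UN_disjoint) auto
    moreover have "{b \<in> Z. range ((*) b) = J} \<inter> (\<Union>J'\<in>\<J>. {b \<in> Z. range ((*) b) = J'}) = {}"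
      by (auto simp: \<J>_def)
    ultimately show ?thesis by (simp add: card_Un_disjoint)
  qed
  have "(\<Sum>J'\<in>\<J>. card {b \<in> X. range ((*) b) = J'}) = (\<Sum>J'\<in>\<J>. card {b \<in> Y. range ((*) b) = J'})"
    by (intro sum.cong refl less.hyps) (auto simp: \<J>_def psubset_card_mono)
  with count[of X] count[of Y] assms(1)[OF less.prems] show ?case by simp
qed

text \<open>Left multiplication by \<open>b\<close> is onto a finite set, hence injective;
  cancelling \<open>b\<close> in \<open>b * (c * b) = b * 1\<close> makes the right inverse
  two-sided.\<close>

lemma ring_unit_of_range_mult:
  fixes b :: "'a::{ring_1,finite}"
  assumes "range ((*) b) = UNIV"
  shows "b \<in> ring_units"
proof -
  have "1 \<in> range ((*) b)" by (simp add: assms)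
  then obtain c where c: "b * c = 1" by auto
  have "inj ((*) b)" using assms by (simp add: finite_UNIV_surj_inj)
  moreover have "b * (c * b) = b * 1" by (simp add: mult.assoc[symmetric] c)
  ultimately have "c * b = 1" by (simp only: inj_eq)
  with c show ?thesis by (auto simp: ring_units_def)
qed

lemma right_smult_vec_assoc: "right_smult_vec (right_smult_vec g a) b = right_smult_vec g (a * b)"
  by (auto simp: right_smult_vec_def mult.assoc)

lemma right_smult_vec_one: "right_smult_vec g 1 = g"
  by (auto simp: right_smult_vec_def)

lemma right_smult_vec_carrier: "g \<in> carrier_vec k \<Longrightarrow> right_smult_vec g a \<in> carrier_vec k"
  by (auto simp: right_smult_vec_def)

lemma right_smult_vec_add:
  "g \<in> carrier_vec k \<Longrightarrow> right_smult_vec g (a + b) = right_smult_vec g a + right_smult_vec g b"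
  by (auto simp: right_smult_vec_def distrib_left)

lemma right_smult_vec_diff:
  "g \<in> carrier_vec k \<Longrightarrow> right_smult_vec g (a - b) = right_smult_vec g a - right_smult_vec g b"
  for g :: "'a::ring_1 vec"
  by (auto simp: right_smult_vec_def right_diff_distrib)

lemma cyclic_generators_unit_multiple:
  fixes g h :: "'a::{ring_1,finite} vec"
  assumes g: "g \<in> carrier_vec k" and "cyclic_right_submodule g = cyclic_right_submodule h"
  shows "\<exists>u\<in>ring_units. h = right_smult_vec g u"
proof -
  have self: "x \<in> cyclic_right_submodule x" for x :: "'a vec"
    unfolding cyclic_right_submodule_def by (rule range_eqI[of _ _ 1]) (simp add: right_smult_vec_one)
  have "h \<in> cyclic_right_submodule g" "g \<in> cyclic_right_submodule h"
    using self[of h] self[of g] assms(2) by simp_all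
  then obtain a b where b: "h = right_smult_vec g b" and a: "g = right_smult_vec h a"
    by (auto simp: cyclic_right_submodule_def)
  define X where "X = {b. right_smult_vec g b = h}"
  define Y where "Y = {b. right_smult_vec g b = g}"
  have h: "h \<in> carrier_vec k" using b g by (simp add: right_smult_vec_carrier)
  have card: "card (X \<inter> J) = card (Y \<inter> J)" if J: "right_ideal J" for J
  proof -
    have add: "x + y \<in> J" and sc: "x * c \<in> J" if "x \<in> J" "y \<in> J" for x y c
      using J that by (auto simp: right_ideal_def)
    have diff: "x - y \<in> J" if "x \<in> J" "y \<in> J" for x y
      using add[of x "y * (- 1)"] sc[of y y "- 1"] that by simp
    show ?thesis
    proof (cases "X \<inter> J = {}")
      case True
      have "s * b \<in> X \<inter> J" if "s \<in> Y \<inter> J" for s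
        using that b sc by (auto simp: X_def Y_def right_smult_vec_assoc[symmetric])
      with True have "Y \<inter> J = {}" by blast
      with True show ?thesis by simp
    next
      case False
      then obtain t where t: "t \<in> J" "right_smult_vec g t = h" by (auto simp: X_def)
      \<comment> \<open>\<open>t\<close> carries \<open>g\<close> to \<open>h\<close> and
        \<open>a\<close> carries \<open>h\<close> back, so \<open>s\<close> fixes \<open>g\<close>;
        translation by \<open>s - t\<close> then matches the two fibres inside
        \<open>J\<close>.\<close>
      define s where "s = t * a"
      have s: "s \<in> J" "right_smult_vec g s = g"
        using t a sc by (auto simp: s_def right_smult_vec_assoc[symmetric])
      have "bij_betw (\<lambda>x. x - t + s) (X \<inter> J) (Y \<inter> J)"
        using s t g h
        by (intro bij_betwI[where g = "\<lambda>x. x - s + t"])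
          (auto simp: X_def Y_def right_smult_vec_add right_smult_vec_diff intro!: add diff)
      then show ?thesis by (rule bij_betw_same_card)
    qed
  qed
  have "right_ideal (UNIV :: 'a set)" by (simp add: right_ideal_def)
  from card_generators_eq[OF card this]
  have "card {b \<in> X. range ((*) b) = UNIV} = card {b \<in> Y. range ((*) b) = UNIV}" by simp
  moreover have "1 \<in> {b \<in> Y. range ((*) b) = UNIV}"
    by (auto simp: Y_def right_smult_vec_one)
  ultimately have "{b \<in> X. range ((*) b) = UNIV} \<noteq> {}"
    by (metis card.empty card_eq_0_iff empty_iff finite)
  then show ?thesis using ring_unit_of_range_mult by (auto simp: X_def)
qed

section \<open>Strongly regular graphs\<close>

text \<open>The nonadjacent pair \<open>x\<close>, \<open>y\<close> has a common neighbour, which in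
  a union of cliques would make it adjacent; so only the complement can be such a union. That
  happens iff nonadjacency is transitive, that is, iff nonadjacent vertices have the same
  neighbourhood.\<close>

lemma trivial_graph_iff:
  assumes sr: "strongly_regular \<Gamma> N K l m" and "m \<noteq> 0"
    and xy: "x \<in> pverts \<Gamma>" "y \<in> pverts \<Gamma>" "x \<noteq> y" "(x, y) \<notin> parcs \<Gamma>"
  shows "trivial_graph \<Gamma> \<longleftrightarrow> m = K"
proof -
  interpret pair_graph \<Gamma> using sr by (simp add: strongly_regular_def)
  define nb where "nb x = {y \<in> pverts \<Gamma>. (x, y) \<in> parcs \<Gamma>}" for x
  have finite: "finite (nb x)" for x by (simp add: nb_def pair_finite_verts)
  have loop: "(x, x) \<notin> parcs \<Gamma>" for x using pair_no_loops[of "(x, x)"] by auto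
  have sym: "(a, b) \<in> parcs \<Gamma> \<Longrightarrow> (b, a) \<in> parcs \<Gamma>" for a b
    by (rule arcs_symmetric)
  have common: "common_neighbours \<Gamma> x y = nb x \<inter> nb y" for x y
    by (auto simp: common_neighbours_def nb_def)
  have K: "card (nb x) = K" if "x \<in> pverts \<Gamma>" for x
    using sr that by (simp add: strongly_regular_def nb_def)
  have m: "card (nb x \<inter> nb y) = m"
    if "x \<in> pverts \<Gamma>" "y \<in> pverts \<Gamma>" "x \<noteq> y" "(x, y) \<notin> parcs \<Gamma>" for x y
    using sr that by (simp add: strongly_regular_def common)
  have "\<not> union_of_equal_cliques \<Gamma>"
  proof
    assume "union_of_equal_cliques \<Gamma>"
    then obtain \<P> where P: "partition_on (pverts \<Gamma>) \<P>"
      and arcs: "parcs \<Gamma> = {(x, y). x \<noteq> y \<and> (\<exists>Q\<in>\<P>. x \<in> Q \<and> y \<in> Q)}"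
      by (auto simp: union_of_equal_cliques_def)
    have "nb x \<inter> nb y \<noteq> {}" using m[OF xy] \<open>m \<noteq> 0\<close> by auto
    then obtain z where "(x, z) \<in> parcs \<Gamma>" "(y, z) \<in> parcs \<Gamma>" by (auto simp: nb_def)
    then obtain Q Q' where "Q \<in> \<P>" "x \<in> Q" "z \<in> Q" "Q' \<in> \<P>" "y \<in> Q'" "z \<in> Q'"
      using arcs by auto
    moreover from this have "Q = Q'"
      using disjointD[OF partition_onD2[OF P]] by blast
    ultimately have "(x, y) \<in> parcs \<Gamma>" using arcs xy(3) by auto
    with xy(4) show False by simp
  qed
  moreover have "m = K" if cliques: "union_of_equal_cliques (complement_graph \<Gamma>)"
  proof -
    obtain \<P> where P: "partition_on (pverts \<Gamma>) \<P>"
      and arcs: "parcs (complement_graph \<Gamma>) = {(x, y). x \<noteq> y \<and> (\<exists>Q\<in>\<P>. x \<in> Q \<and> y \<in> Q)}"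
      using cliques unfolding union_of_equal_cliques_def by (auto simp: complement_graph_def)
    have compl: "x \<in> pverts \<Gamma> \<and> y \<in> pverts \<Gamma> \<and> x \<noteq> y \<and> (x, y) \<notin> parcs \<Gamma> \<longleftrightarrow>
        x \<noteq> y \<and> (\<exists>Q\<in>\<P>. x \<in> Q \<and> y \<in> Q)" for x y
      using arcs by (auto simp: complement_graph_def set_eq_iff)
    obtain Q where Q: "Q \<in> \<P>" "x \<in> Q" "y \<in> Q" using compl[of x y] xy by blast
    \<comment> \<open>A neighbour of \<open>x\<close> not adjacent to \<open>y\<close> would share a
      clique of the complement with \<open>y\<close>, hence with \<open>x\<close>.\<close>
    have "nb x \<subseteq> nb y"
    proof
      fix z assume z: "z \<in> nb x"
      show "z \<in> nb y"
      proof (rule ccontr)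
        assume "z \<notin> nb y"
        then have "y \<noteq> z \<and> (y, z) \<notin> parcs \<Gamma>" using z xy(4) by (auto simp: nb_def)
        then obtain Q' where Q': "Q' \<in> \<P>" "y \<in> Q'" "z \<in> Q'"
          using compl[of y z] xy(2) z by (auto simp: nb_def)
        with Q have "Q' = Q"
          using disjointD[OF partition_onD2[OF P]] by blast
        with Q Q' have "x = z \<or> (x, z) \<notin> parcs \<Gamma>" using compl[of x z] by blast
        with z loop[of x] show False by (auto simp: nb_def)
      qed
    qed
    then show ?thesis using m[OF xy] K[OF xy(1)] by (simp add: Int_absorb2)
  qed
  moreover have "union_of_equal_cliques (complement_graph \<Gamma>)" if "m = K"
  proof -
    have nb_eq: "nb x = nb y \<longleftrightarrow> (x, y) \<notin> parcs \<Gamma>" if "x \<in> pverts \<Gamma>" "y \<in> pverts \<Gamma>" for x y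
    proof
      assume "nb x = nb y"
      then show "(x, y) \<notin> parcs \<Gamma>" using loop[of y] that by (auto simp: nb_def)
    next
      assume xy: "(x, y) \<notin> parcs \<Gamma>"
      show "nb x = nb y"
      proof (cases "x = y")
        case False
        have "card (nb x \<inter> nb y) = card (nb x)" "card (nb x \<inter> nb y) = card (nb y)"
          using m[OF that False xy] K that \<open>m = K\<close> by auto
        then have "nb x \<inter> nb y = nb x" "nb x \<inter> nb y = nb y"
          by (meson Int_lower1 Int_lower2 card_subset_eq finite)+
        then show ?thesis by simp
      qed simp
    qed
    \<comment> \<open>Since nonadjacency now means equal neighbourhoods, the set of non-neighbours
      of \<open>x\<close> is its equivalence class.\<close>
    define \<P> where "\<P> = (\<lambda>x. pverts \<Gamma> - nb x) ` pverts \<Gamma>"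
    have cls: "z \<in> pverts \<Gamma> - nb x \<longleftrightarrow> z \<in> pverts \<Gamma> \<and> nb z = nb x" if "x \<in> pverts \<Gamma>" for x z
      using nb_eq[OF that, of z] by (auto simp: nb_def)
    have "partition_on (pverts \<Gamma>) \<P>"
    proof (rule partition_onI)
      show "\<Union> \<P> = pverts \<Gamma>" using cls by (auto simp: \<P>_def)
      show "{} \<notin> \<P>" using cls unfolding \<P>_def by blast
      show "disjnt p p'" if pp: "p \<in> \<P>" "p' \<in> \<P>" "p \<noteq> p'" for p p'
      proof -
        obtain x x' where x: "x \<in> pverts \<Gamma>" "x' \<in> pverts \<Gamma>" "p = pverts \<Gamma> - nb x" "p' = pverts \<Gamma> - nb x'"
          using pp by (auto simp: \<P>_def)
        then have "nb x \<noteq> nb x'" using pp(3) by auto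
        then show ?thesis unfolding disjnt_iff x(3,4) using cls x(1,2) by metis
      qed
    qed
    moreover have "\<forall>Q\<in>\<P>. card Q = card (pverts \<Gamma>) - K"
    proof
      fix Q assume "Q \<in> \<P>"
      then obtain x where "x \<in> pverts \<Gamma>" "Q = pverts \<Gamma> - nb x" by (auto simp: \<P>_def)
      then show "card Q = card (pverts \<Gamma>) - K"
        using K[of x] finite[of x] by (simp add: card_Diff_subset nb_def)
    qed
    moreover have "(x \<in> pverts \<Gamma> \<and> y \<in> pverts \<Gamma> \<and> x \<noteq> y \<and> (x, y) \<notin> parcs \<Gamma>) \<longleftrightarrow>
        x \<noteq> y \<and> (\<exists>Q\<in>\<P>. x \<in> Q \<and> y \<in> Q)" for x y
      unfolding \<P>_def bex_simps using cls nb_eq by metis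
    ultimately show ?thesis
      unfolding union_of_equal_cliques_def
      by (intro exI[of _ \<P>] exI[of _ "card (pverts \<Gamma>) - K"]) (simp add: complement_graph_def)
  qed
  ultimately show ?thesis by (auto simp: trivial_graph_def)
qed

section \<open>Graphs of codes\<close>

lemma finite_carrier_vec: "finite (carrier_vec n :: 'a::finite vec set)"
proof -
  have "finite (vec_of_list ` {xs :: 'a list. set xs \<subseteq> UNIV \<and> length xs = n})"
    by (intro finite_imageI finite_lists_length_eq) simp
  moreover have "carrier_vec n \<subseteq> vec_of_list ` {xs :: 'a list. set xs \<subseteq> UNIV \<and> length xs = n}"
  proof
    fix v :: "'a vec" assume "v \<in> carrier_vec n"
    then show "v \<in> vec_of_list ` {xs. set xs \<subseteq> UNIV \<and> length xs = n}"
      by (intro image_eqI[of _ _ "list_of_vec v"]) (auto simp: vec_list)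
  qed
  ultimately show ?thesis by (rule rev_finite_subset)
qed

lemma zero_coset_trivial:
  assumes "V \<subseteq> carrier_vec m" "words_of_weight V 0 = {0\<^sub>v m}" "c \<in> V"
  shows "zero_coset V c = {c}"
  using assms by (auto simp: zero_coset_def)

text \<open>The orthogonality relation \<open>\<beta>_orth\<close> says that every character of \<open>V\<close> occurs equally often in the
  family.\<close>

locale character_family =
  fixes m :: nat and V :: "'a::{ring_1,finite} vec set" and W :: "'w set"
    and \<beta> :: "'a vec \<Rightarrow> 'w \<Rightarrow> complex"
  assumes V_carrier: "V \<subseteq> carrier_vec m"
    and V_zero: "0\<^sub>v m \<in> V"
    and V_add: "\<And>u v. u \<in> V \<Longrightarrow> v \<in> V \<Longrightarrow> u + v \<in> V"
    and V_uminus: "\<And>v. v \<in> V \<Longrightarrow> - v \<in> V"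
    and W_finite: "finite W" "W \<noteq> {}"
    and \<beta>_add: "\<And>u v w. u \<in> V \<Longrightarrow> v \<in> V \<Longrightarrow> w \<in> W \<Longrightarrow> \<beta> (u + v) w = \<beta> u w * \<beta> v w"
    and \<beta>_orth: "\<And>v. v \<in> V \<Longrightarrow> (\<Sum>w\<in>W. \<beta> v w) = (if v = 0\<^sub>v m then of_nat (card W) else 0)"
begin

lemma V_finite: "finite V"
  using V_carrier finite_carrier_vec by (rule finite_subset)

lemma V_dim: "v \<in> V \<Longrightarrow> dim_vec v = m"
  using V_carrier by auto

lemma V_minus: "u \<in> V \<Longrightarrow> v \<in> V \<Longrightarrow> u - v \<in> V"
  using V_add[of u "- v"] V_uminus[of v] V_carrier minus_add_uminus_vec[of u m v] by (simp add: subsetD)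

lemma \<beta>_sum:
  assumes w: "w \<in> W"
  shows "(\<Sum>v\<in>V. \<beta> v w) = (if \<forall>v\<in>V. \<beta> v w = 1 then of_nat (card V) else 0)"
proof (cases "\<forall>v\<in>V. \<beta> v w = 1")
  case False
  then obtain v0 where v0: "v0 \<in> V" "\<beta> v0 w \<noteq> 1" by auto
  have "bij_betw (\<lambda>v. v0 + v) V V"
  proof (rule bij_betwI[where g = "\<lambda>v. v - v0"])
    show "v0 + v - v0 = v" "v0 + (v - v0) = v" if "v \<in> V" for v
      using V_dim[OF that] V_dim[OF v0(1)] by (auto intro!: eq_vecI)
  qed (use v0 V_add V_minus in auto)
  then have "(\<Sum>v\<in>V. \<beta> v w) = 0"
    by (rule sum_eq_zero_by_shift[OF _ _ v0(2)]) (use v0 \<beta>_add w in auto)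
  then show ?thesis by (simp only: False if_False)
qed simp

text \<open>All values of \<open>\<beta>\<close> are summed in both orders. The result weights the
  trivial character in \<open>representation_count\<close> and later compares the sizes of
  \<open>C'\<close> and \<open>C\<close>.\<close>

lemma \<beta>_trivial_character_count:
  "card V * card {w \<in> W. \<forall>v\<in>V. \<beta> v w = 1} = card W"
proof -
  have "(\<Sum>w\<in>W. \<Sum>v\<in>V. \<beta> v w) = of_nat (card V * card {w \<in> W. \<forall>v\<in>V. \<beta> v w = 1})"
    using W_finite by (simp add: \<beta>_sum sum.If_cases Int_def mult.commute)
  moreover have "(\<Sum>w\<in>W. \<Sum>v\<in>V. \<beta> v w) = (\<Sum>v\<in>V. \<Sum>w\<in>W. \<beta> v w)"
    by (rule sum.swap)
  moreover have "\<dots> = of_nat (card W)"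
    using V_finite V_zero by (simp add: \<beta>_orth)
  ultimately show ?thesis by (simp only: of_nat_eq_iff)
qed

text \<open>The number of representations \<open>v = s + t\<close> is read off the Fourier transform of \<open>S\<close>,
  whose square is a combination of the transform itself, a constant, and the indicator of the
  trivial character.\<close>

lemma representation_count:
  fixes \<theta>1 \<theta>2 :: real
  assumes S: "S \<subseteq> V" and v: "v \<in> V"
    and spectrum: "\<And>w. w \<in> W \<Longrightarrow> (\<exists>v\<in>V. \<beta> v w \<noteq> 1) \<Longrightarrow>
      (\<Sum>s\<in>S. \<beta> s w) = of_real \<theta>1 \<or> (\<Sum>s\<in>S. \<beta> s w) = of_real \<theta>2"
  shows "real (card {s \<in> S. v - s \<in> S}) =
    (\<theta>1 + \<theta>2) * of_bool (v \<in> S) - \<theta>1 * \<theta>2 * of_bool (v = 0\<^sub>v m) +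
    (real (card S) - \<theta>1) * (real (card S) - \<theta>2) / real (card V)"
proof -
  define F where "F w = (\<Sum>s\<in>S. \<beta> s w)" for w
  define Z where "Z = {w \<in> W. \<forall>v\<in>V. \<beta> v w = 1}"
  define c where "c = (real (card S) - \<theta>1) * (real (card S) - \<theta>2)"
  have finS: "finite S" using S V_finite by (rule finite_subset)
  have SV: "s \<in> V" if "s \<in> S" for s using S that by auto
  \<comment> \<open>Off \<open>Z\<close> the transform is a root of the quadratic with roots
    \<open>\<theta>1\<close>, \<open>\<theta>2\<close>; on \<open>Z\<close> it equals
    \<open>card S\<close>, and \<open>c\<close> is the value of the quadratic there.\<close>
  have F: "F w ^ 2 = of_real (\<theta>1 + \<theta>2) * F w - of_real (\<theta>1 * \<theta>2) + of_real c * of_bool (w \<in> Z)"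
    if w: "w \<in> W" for w
  proof (cases "w \<in> Z")
    case True
    then have "F w = (\<Sum>s\<in>S. 1)" unfolding F_def Z_def using S by (intro sum.cong) auto
    then have "F w = of_real (real (card S))" by simp
    then show ?thesis using True by (simp add: c_def power2_eq_square algebra_simps)
  next
    case False
    then have "F w = of_real \<theta>1 \<or> F w = of_real \<theta>2" using spectrum[OF w] w by (auto simp: F_def Z_def)
    then show ?thesis using False by (auto simp: power2_eq_square algebra_simps)
  qed
  have minus_v: "- v \<in> V" using v by (rule V_uminus)
  have rep: "s + t + - v = 0\<^sub>v m \<longleftrightarrow> v - s = t" if "s \<in> V" "t \<in> V" for s t
  proof -
    have [simp]: "dim_vec s = m" "dim_vec t = m" "dim_vec v = m" using that v V_carrier by auto
    have "x + y + - z = 0 \<longleftrightarrow> z - x = y" for x y z :: 'a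
      by (auto simp: diff_eq_eq add.commute)
    then show ?thesis by (simp add: vec_eq_iff)
  qed
  have single: "s + - v = 0\<^sub>v m \<longleftrightarrow> s = v" if "s \<in> V" for s
  proof -
    have [simp]: "dim_vec s = m" "dim_vec v = m" using that v V_carrier by auto
    show ?thesis by (simp add: vec_eq_iff)
  qed
  have minus_zero: "- v = 0\<^sub>v m \<longleftrightarrow> v = 0\<^sub>v m"
  proof -
    have [simp]: "dim_vec v = m" using v V_carrier by auto
    show ?thesis by (simp add: vec_eq_iff)
  qed
  \<comment> \<open>Fourier inversion at \<open>v\<close>: orthogonality keeps only the pairs with
    \<open>s + t = v\<close>. Below, the same sum is evaluated through the quadratic relation
    \<open>F\<close>.\<close>
  have "(\<Sum>w\<in>W. F w ^ 2 * \<beta> (- v) w) = (\<Sum>w\<in>W. \<Sum>s\<in>S. \<Sum>t\<in>S. \<beta> (s + t + - v) w)"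
  proof (intro sum.cong refl)
    fix w assume w: "w \<in> W"
    have "F w ^ 2 = (\<Sum>s\<in>S. \<Sum>t\<in>S. \<beta> s w * \<beta> t w)"
      by (simp only: F_def power2_eq_square sum_product)
    then have "F w ^ 2 * \<beta> (- v) w = (\<Sum>s\<in>S. \<Sum>t\<in>S. \<beta> s w * \<beta> t w * \<beta> (- v) w)"
      by (simp only: sum_distrib_right)
    also have "\<dots> = (\<Sum>s\<in>S. \<Sum>t\<in>S. \<beta> (s + t + - v) w)"
      using w minus_v by (intro sum.cong refl) (simp add: \<beta>_add V_add SV)
    finally show "F w ^ 2 * \<beta> (- v) w = (\<Sum>s\<in>S. \<Sum>t\<in>S. \<beta> (s + t + - v) w)" .
  qed
  also have "\<dots> = (\<Sum>s\<in>S. \<Sum>t\<in>S. \<Sum>w\<in>W. \<beta> (s + t + - v) w)"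
    by (subst sum.swap, intro sum.cong refl, subst sum.swap) simp
  also have "\<dots> = (\<Sum>s\<in>S. \<Sum>t\<in>S. if v - s = t then of_nat (card W) else 0)"
    using minus_v by (intro sum.cong refl) (simp add: \<beta>_orth V_add rep SV)
  also have "\<dots> = (\<Sum>s\<in>S. if v - s \<in> S then of_nat (card W) else 0)"
    using finS by simp
  also have "\<dots> = of_nat (card W) * of_nat (card {s \<in> S. v - s \<in> S})"
    using finS by (simp add: sum.If_cases Int_def mult.commute)
  finally have lhs: "(\<Sum>w\<in>W. F w ^ 2 * \<beta> (- v) w) = of_nat (card W) * of_nat (card {s \<in> S. v - s \<in> S})" .
  have "(\<Sum>w\<in>W. F w ^ 2 * \<beta> (- v) w) =
      (\<Sum>w\<in>W. of_real (\<theta>1 + \<theta>2) * (F w * \<beta> (- v) w) - of_real (\<theta>1 * \<theta>2) * \<beta> (- v) w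
        + of_real c * (if w \<in> Z then 1 else 0))"
  proof (intro sum.cong refl)
    fix w assume w: "w \<in> W"
    have "w \<in> Z \<Longrightarrow> \<beta> (- v) w = 1" using minus_v by (simp add: Z_def)
    then show "F w ^ 2 * \<beta> (- v) w = of_real (\<theta>1 + \<theta>2) * (F w * \<beta> (- v) w) -
        of_real (\<theta>1 * \<theta>2) * \<beta> (- v) w + of_real c * (if w \<in> Z then 1 else 0)"
      by (simp only: F[OF w]) (auto simp: algebra_simps)
  qed
  also have "\<dots> = of_real (\<theta>1 + \<theta>2) * (\<Sum>w\<in>W. F w * \<beta> (- v) w)
      - of_real (\<theta>1 * \<theta>2) * (\<Sum>w\<in>W. \<beta> (- v) w) + of_real c * (\<Sum>w\<in>W. if w \<in> Z then 1 else 0)"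
    by (simp only: sum.distrib sum_subtractf sum_distrib_left)
  also have "(\<Sum>w\<in>W. F w * \<beta> (- v) w) = of_nat (card W) * of_bool (v \<in> S)"
  proof -
    have "(\<Sum>w\<in>W. F w * \<beta> (- v) w) = (\<Sum>w\<in>W. \<Sum>s\<in>S. \<beta> (s + - v) w)"
      using minus_v by (intro sum.cong refl) (simp add: F_def sum_distrib_right \<beta>_add SV)
    also have "\<dots> = (\<Sum>s\<in>S. \<Sum>w\<in>W. \<beta> (s + - v) w)" by (rule sum.swap)
    also have "\<dots> = (\<Sum>s\<in>S. if s = v then of_nat (card W) else 0)"
      using minus_v by (intro sum.cong refl) (simp add: \<beta>_orth V_add single SV)
    finally show ?thesis using finS by simp
  qed
  also have "(\<Sum>w\<in>W. \<beta> (- v) w) = of_nat (card W) * of_bool (v = 0\<^sub>v m)"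
    by (simp add: \<beta>_orth[OF minus_v] minus_zero)
  also have "(\<Sum>w\<in>W. if w \<in> Z then 1 else 0) = (of_nat (card Z) :: complex)"
    using W_finite by (simp add: sum.If_cases Z_def Int_def)
  finally have "complex_of_real (real (card W) * real (card {s \<in> S. v - s \<in> S})) =
      of_real ((\<theta>1 + \<theta>2) * (real (card W) * of_bool (v \<in> S))
        - \<theta>1 * \<theta>2 * (real (card W) * of_bool (v = 0\<^sub>v m)) + c * real (card Z))"
    unfolding lhs by simp
  then have eq: "real (card W) * real (card {s \<in> S. v - s \<in> S}) =
      (\<theta>1 + \<theta>2) * (real (card W) * of_bool (v \<in> S))
        - \<theta>1 * \<theta>2 * (real (card W) * of_bool (v = 0\<^sub>v m)) + c * real (card Z)"
    by (simp only: of_real_eq_iff)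
  have W_pos: "real (card W) > 0" using W_finite by (simp add: card_gt_0_iff)
  have "real (card V) * real (card Z) = real (card W)"
    using arg_cong[OF \<beta>_trivial_character_count, of real] by (simp add: Z_def)
  moreover have "real (card V) \<noteq> 0" using V_finite V_zero by auto
  ultimately have Z: "real (card Z) = real (card W) / real (card V)"
    by (simp add: nonzero_eq_divide_eq mult.commute)
  have "real (card W) * real (card {s \<in> S. v - s \<in> S}) = real (card W) *
      ((\<theta>1 + \<theta>2) * of_bool (v \<in> S) - \<theta>1 * \<theta>2 * of_bool (v = 0\<^sub>v m) + c / real (card V))"
    unfolding eq Z by (simp add: algebra_simps)
  then show ?thesis using W_pos unfolding c_def by simp
qed

end

section \<open>Strong regularity from two nontrivial eigenvalues\<close>

lemma hom_weight_vec_uminus: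
  assumes "frobenius_ring TYPE('a::{ring_1,finite})"
  shows "hom_weight_vec (- v) = hom_weight_vec (v :: 'a vec)"
proof -
  have "hom_weight (- x) = hom_weight x" for x :: 'a
    using hom_weight_unit_mult[OF assms, of "- 1" x] one_ring_units[where ?'a = 'a]
    by (simp add: uminus_ring_units)
  then show ?thesis by (simp add: hom_weight_vec_def)
qed

text \<open>The graph is a Cayley graph on \<open>V\<close> with the symmetric connection set
  \<open>S\<close>. Common neighbours of \<open>c\<close> and \<open>d\<close> correspond to
  representations of \<open>c - d\<close> as a sum of two elements of \<open>S\<close>, and
  \<open>representation_count\<close> makes their number depend only on whether \<open>c - d\<close>
  is zero, in \<open>S\<close>, or neither. The witnesses \<open>s0\<close> and \<open>v0\<close>
  ensure that the last two cases occur.\<close>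

lemma (in character_family) code_graph_strongly_regular:
  fixes \<theta>1 \<theta>2 :: real
  defines "S \<equiv> words_of_weight V (smaller_weight V)"
  defines "\<mu> \<equiv> (real (card S) - \<theta>1) * (real (card S) - \<theta>2) / real (card V)"
  assumes frobenius: "frobenius_ring TYPE('a)"
    and zero: "words_of_weight V 0 = {0\<^sub>v m}" and smaller: "smaller_weight V \<noteq> 0"
    and s0: "s0 \<in> S" and v0: "v0 \<in> V" "v0 \<notin> S" "v0 \<noteq> 0\<^sub>v m"
    and spectrum: "\<forall>w\<in>W. (\<exists>v\<in>V. \<beta> v w \<noteq> 1) \<longrightarrow>
      (\<Sum>s\<in>S. \<beta> s w) = of_real \<theta>1 \<or> (\<Sum>s\<in>S. \<beta> s w) = of_real \<theta>2"
  shows "\<exists>l m'. strongly_regular (code_graph V) (card V) (card S) l m' \<and>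
      real l = \<theta>1 + \<theta>2 + \<mu> \<and> real m' = \<mu>"
    and "real (card S) = \<mu> - \<theta>1 * \<theta>2"
    and "\<mu> \<noteq> 0 \<Longrightarrow> trivial_graph (code_graph V) \<longleftrightarrow> \<theta>1 * \<theta>2 = 0"
proof -
  have S: "S \<subseteq> V" by (auto simp: S_def words_of_weight_def)
  have "hom_weight_vec (0\<^sub>v m :: 'a vec) = 0" using zero unfolding words_of_weight_def by blast
  then have zero_S: "0\<^sub>v m \<notin> S"
    using smaller by (simp add: S_def words_of_weight_def)
  have S_uminus: "- v \<in> S" if "v \<in> S" for v
    using that V_uminus by (simp add: S_def words_of_weight_def hom_weight_vec_uminus[OF frobenius])
  have S_swap: "d - c \<in> S" if "c - d \<in> S" "c \<in> V" "d \<in> V" for c d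
  proof -
    have "d - c = - (c - d)" using V_dim[OF that(2)] V_dim[OF that(3)] by (intro eq_vecI) auto
    then show ?thesis using S_uminus[OF that(1)] by simp
  qed
  define R where "R v = card {s \<in> S. v - s \<in> S}" for v
  have R: "real (R v) = (\<theta>1 + \<theta>2) * of_bool (v \<in> S) - \<theta>1 * \<theta>2 * of_bool (v = 0\<^sub>v m) + \<mu>"
    if "v \<in> V" for v
    unfolding R_def \<mu>_def by (rule representation_count[OF S that]) (use spectrum in blast)
  have verts: "pverts (code_graph V) = (\<lambda>c. {c}) ` V"
    using zero_coset_trivial[OF V_carrier zero] by (auto simp: code_graph_def)
  have arcs: "(x, y) \<in> parcs (code_graph V) \<longleftrightarrow> (\<exists>c\<in>V. \<exists>d\<in>V. x = {c} \<and> y = {d} \<and> c - d \<in> S)" for x y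
    using zero_coset_trivial[OF V_carrier zero] V_minus
    by (auto simp: code_graph_def S_def words_of_weight_def)
  have arcs': "({c}, {d}) \<in> parcs (code_graph V) \<longleftrightarrow> c - d \<in> S" if "c \<in> V" "d \<in> V" for c d
    using that by (auto simp: arcs)
  have graph: "pair_graph (code_graph V)"
  proof
    show "fst e \<in> pverts (code_graph V)" if "e \<in> parcs (code_graph V)" for e
      using that by (cases e) (auto simp: arcs verts)
    show "snd e \<in> pverts (code_graph V)" if "e \<in> parcs (code_graph V)" for e
      using that by (cases e) (auto simp: arcs verts)
    show "finite (pverts (code_graph V))" by (simp add: verts V_finite)
    have "parcs (code_graph V) \<subseteq> pverts (code_graph V) \<times> pverts (code_graph V)"
      by (auto simp: arcs verts)
    then show "finite (parcs (code_graph V))"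
      by (rule finite_subset) (simp add: verts V_finite)
    show "fst e \<noteq> snd e" if e: "e \<in> parcs (code_graph V)" for e
    proof
      assume "fst e = snd e"
      then obtain c where "c \<in> V" "c - c \<in> S" using e by (cases e) (auto simp: arcs)
      then show False using zero_S V_carrier by auto
    qed
    show "symmetric (with_proj (code_graph V))"
      unfolding symmetric_def by (auto simp: arcs sym_def intro: S_swap)
  qed
  have K: "card {y \<in> pverts (code_graph V). ({c}, y) \<in> parcs (code_graph V)} = card S" if c: "c \<in> V" for c
  proof -
    have "bij_betw (\<lambda>s. {c - s}) S {y \<in> pverts (code_graph V). ({c}, y) \<in> parcs (code_graph V)}"
    proof (rule bij_betw_imageI)
      have cancel: "c - (c - s) = s" if "s \<in> V" for s
        using V_dim[OF c] V_dim[OF that] by (intro eq_vecI) auto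
      then show "inj_on (\<lambda>s. {c - s}) S"
        using S by (intro inj_onI) (metis singleton_inject subsetD)
      show "(\<lambda>s. {c - s}) ` S = {y \<in> pverts (code_graph V). ({c}, y) \<in> parcs (code_graph V)}"
      proof (intro equalityI subsetI)
        fix y assume "y \<in> (\<lambda>s. {c - s}) ` S"
        then show "y \<in> {y \<in> pverts (code_graph V). ({c}, y) \<in> parcs (code_graph V)}"
          using S c V_minus by (auto simp: arcs' verts cancel subsetD)
      next
        fix y assume "y \<in> {y \<in> pverts (code_graph V). ({c}, y) \<in> parcs (code_graph V)}"
        then obtain d where d: "d \<in> V" "y = {d}" "c - d \<in> S" using c by (auto simp: arcs' verts)
        then show "y \<in> (\<lambda>s. {c - s}) ` S"
          by (intro image_eqI[of _ _ "c - d"]) (simp_all add: cancel)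
      qed
    qed
    then show ?thesis by (rule bij_betw_same_card[symmetric])
  qed
  have common: "card (common_neighbours (code_graph V) {c} {d}) = R (c - d)" if c: "c \<in> V" and d: "d \<in> V" for c d
  proof -
    have cancel: "c - (c - s) = s" "c - d - (c - s) = - (d - s)" "d - (c - s) = - ((c - d) - s)" if "s \<in> V" for s
      using V_dim[OF c] V_dim[OF d] V_dim[OF that] by (auto intro!: eq_vecI)
    have uminus_S: "- v \<in> S \<longleftrightarrow> v \<in> S" for v
      using S_uminus[of v] S_uminus[of "- v"] by auto
    have "bij_betw (\<lambda>s. {c - s}) {s \<in> S. (c - d) - s \<in> S} (common_neighbours (code_graph V) {c} {d})"
    proof (rule bij_betw_imageI)
      show "inj_on (\<lambda>s. {c - s}) {s \<in> S. (c - d) - s \<in> S}"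
        using S cancel(1) by (intro inj_onI) (metis (no_types, lifting) mem_Collect_eq singleton_inject subsetD)
      show "(\<lambda>s. {c - s}) ` {s \<in> S. (c - d) - s \<in> S} = common_neighbours (code_graph V) {c} {d}"
      proof (intro equalityI subsetI)
        fix y assume "y \<in> (\<lambda>s. {c - s}) ` {s \<in> S. (c - d) - s \<in> S}"
        then show "y \<in> common_neighbours (code_graph V) {c} {d}"
          using S c d V_minus unfolding common_neighbours_def
          by (auto simp: arcs' verts cancel uminus_S subsetD)
      next
        fix y assume "y \<in> common_neighbours (code_graph V) {c} {d}"
        then obtain z where z: "z \<in> V" "y = {z}" "c - z \<in> S" "d - z \<in> S"
          using c d by (auto simp: arcs' verts common_neighbours_def)
        then show "y \<in> (\<lambda>s. {c - s}) ` {s \<in> S. (c - d) - s \<in> S}"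
          by (intro image_eqI[of _ _ "c - z"]) (simp_all add: cancel uminus_S)
      qed
    qed
    then show ?thesis unfolding R_def by (rule bij_betw_same_card[symmetric])
  qed
  have diff_zero: "c = d" if "c - d = 0\<^sub>v m" "c \<in> V" "d \<in> V" for c d
    using that V_dim[of c] V_dim[of d] by (auto simp: vec_eq_iff)
  have s0_V: "s0 \<in> V" "s0 \<noteq> 0\<^sub>v m" using s0 S zero_S by auto
  \<comment> \<open>Taking \<open>R s0\<close> and \<open>R v0\<close> as parameters provides
    natural numbers at once; integrality of the real formulas need not be proved separately.\<close>
  have R_eq: "R v = R (if v \<in> S then s0 else v0)" if "v \<in> V" "v \<noteq> 0\<^sub>v m" for v
  proof -
    have "real (R v) = real (R (if v \<in> S then s0 else v0))"
      using R[OF that(1)] R[OF s0_V(1)] R[OF v0(1)] that s0 s0_V v0 by simp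
    then show ?thesis by (simp only: of_nat_eq_iff)
  qed
  have sr: "strongly_regular (code_graph V) (card V) (card S) (R s0) (R v0)"
    unfolding strongly_regular_def
  proof (intro conjI ballI impI)
    show "card (pverts (code_graph V)) = card V"
      unfolding verts by (intro card_image inj_onI) simp
    show "card {y \<in> pverts (code_graph V). (x, y) \<in> parcs (code_graph V)} = card S"
      if "x \<in> pverts (code_graph V)" for x
      using that K by (auto simp: verts)
    fix x y assume "x \<in> pverts (code_graph V)" "y \<in> pverts (code_graph V)"
    then obtain c d where cd: "c \<in> V" "d \<in> V" "x = {c}" "y = {d}" by (auto simp: verts)
    have diff: "c - d \<in> V" using cd V_minus by simp
    show "card (common_neighbours (code_graph V) x y) = R s0" if "(x, y) \<in> parcs (code_graph V)"
    proof -
      have "c - d \<in> S" using that cd by (simp add: arcs')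
      then have "R (c - d) = R s0" using R_eq[OF diff] zero_S by fastforce
      then show ?thesis using cd by (simp add: common)
    qed
    show "card (common_neighbours (code_graph V) x y) = R v0" if "x \<noteq> y \<and> (x, y) \<notin> parcs (code_graph V)"
    proof -
      have "c - d \<notin> S" using that arcs'[OF cd(1,2)] cd(3,4) by simp
      moreover have "c \<noteq> d" using that cd(3,4) by simp
      then have "c - d \<noteq> 0\<^sub>v m" using diff_zero cd(1,2) by blast
      ultimately have "R (c - d) = R v0" using R_eq[OF diff] by simp
      then show ?thesis using cd by (simp add: common)
    qed
  qed (rule graph)
  have l: "real (R s0) = \<theta>1 + \<theta>2 + \<mu>" and m: "real (R v0) = \<mu>"
    using R[OF s0_V(1)] R[OF v0(1)] s0 s0_V v0 by auto
  show "\<exists>l m'. strongly_regular (code_graph V) (card V) (card S) l m' \<and>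
      real l = \<theta>1 + \<theta>2 + \<mu> \<and> real m' = \<mu>"
    using sr l m by blast
  \<comment> \<open>Each \<open>s\<close> pairs with \<open>- s\<close>, so zero has exactly
    \<open>card S\<close> representations; comparing with the formula gives the degree.\<close>
  have "0\<^sub>v m - s \<in> S" if "s \<in> S" for s
    using that S S_uminus[OF that] V_carrier zero_minus_vec[of s m] by (simp add: subset_iff)
  then have "{s \<in> S. 0\<^sub>v m - s \<in> S} = S" by blast
  then show K_eq: "real (card S) = \<mu> - \<theta>1 * \<theta>2"
    using R[OF V_zero] zero_S by (simp add: R_def)
  assume \<mu>: "\<mu> \<noteq> 0"
  have "R v0 \<noteq> 0"
  proof
    assume "R v0 = 0"
    with m \<mu> show False by (simp only: of_nat_0)
  qed
  then have "trivial_graph (code_graph V) \<longleftrightarrow> R v0 = card S"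
  proof (rule trivial_graph_iff[OF sr])
    show "{v0} \<in> pverts (code_graph V)" "{0\<^sub>v m} \<in> pverts (code_graph V)" "{v0} \<noteq> {0\<^sub>v m}"
      using v0 V_zero by (auto simp: verts)
    have "v0 - 0\<^sub>v m = v0" using v0 V_carrier by (intro minus_zero_vec) auto
    then show "({v0}, {0\<^sub>v m}) \<notin> parcs (code_graph V)"
      using v0 V_zero by (simp add: arcs')
  qed
  also have "\<dots> \<longleftrightarrow> real (R v0) = real (card S)" by simp
  also have "\<dots> \<longleftrightarrow> \<theta>1 * \<theta>2 = 0" unfolding K_eq m by auto
  finally show "trivial_graph (code_graph V) \<longleftrightarrow> \<theta>1 * \<theta>2 = 0" .
qed

section \<open>Modular codes\<close>

text \<open>Orbit-stabiliser for units acting on the right: multiplication by an inverse unit moves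
  every fibre to the one over \<open>g\<close>.\<close>

lemma card_unit_fibre:
  fixes g :: "'a::{ring_1,finite} vec"
  assumes "z \<in> right_smult_vec g ` ring_units"
  shows "card {u \<in> ring_units. right_smult_vec g u = z} * card (right_smult_vec g ` ring_units) =
    card (ring_units :: 'a set)"
proof -
  have fibre: "card {u \<in> ring_units. right_smult_vec g u = z} = card {u \<in> ring_units. right_smult_vec g u = g}"
    if z: "z \<in> right_smult_vec g ` ring_units" for z
  proof -
    obtain u1 where u1: "u1 \<in> ring_units" "z = right_smult_vec g u1" using z by auto
    obtain v1 where v1: "u1 * v1 = 1" "v1 * u1 = 1" using u1(1) by (auto simp: ring_units_def)
    have v1_unit: "v1 \<in> ring_units" using v1 by (auto simp: ring_units_def)
    have zv: "right_smult_vec z v1 = g"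
      using u1(2) v1 by (simp add: right_smult_vec_assoc right_smult_vec_one)
    have units: "u * u1 \<in> ring_units" "u * v1 \<in> ring_units" if "u \<in> ring_units" for u
      using that bij_betw_mult_right_units[OF u1(1)] bij_betw_mult_right_units[OF v1_unit]
      by (auto simp: bij_betw_def)
    have "bij_betw (\<lambda>u. u * v1) {u \<in> ring_units. right_smult_vec g u = z}
        {u \<in> ring_units. right_smult_vec g u = g}"
    proof (rule bij_betwI[where g = "\<lambda>u. u * u1"])
      show "(\<lambda>u. u * v1) \<in> {u \<in> ring_units. right_smult_vec g u = z} \<rightarrow> {u \<in> ring_units. right_smult_vec g u = g}"
        using units zv by (auto simp: right_smult_vec_assoc[symmetric])
      show "(\<lambda>u. u * u1) \<in> {u \<in> ring_units. right_smult_vec g u = g} \<rightarrow> {u \<in> ring_units. right_smult_vec g u = z}"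
        using units u1(2) by (auto simp: right_smult_vec_assoc[symmetric])
    qed (use v1 in \<open>simp_all add: mult.assoc\<close>)
    then show ?thesis by (rule bij_betw_same_card)
  qed
  have "card (ring_units :: 'a set) =
      (\<Sum>y\<in>right_smult_vec g ` ring_units. card {u \<in> ring_units. right_smult_vec g u = y})"
    using sum.image_gen[of "ring_units :: 'a set" "\<lambda>_. 1::nat" "right_smult_vec g"] by simp
  also have "\<dots> = (\<Sum>y\<in>right_smult_vec g ` ring_units. card {u \<in> ring_units. right_smult_vec g u = z})"
    by (intro sum.cong refl) (simp add: fibre assms)
  finally show ?thesis by simp
qed

lemma scalar_prod_right_smult:
  "x \<in> carrier_vec k \<Longrightarrow> y \<in> carrier_vec k \<Longrightarrow> x \<bullet> right_smult_vec y a = (x \<bullet> y) * a"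
  by (simp add: scalar_prod_def right_smult_vec_def sum_distrib_right mult.assoc)

lemma scalar_prod_nondegenerate:
  fixes h h' :: "'a::ring_1 vec"
  assumes "h \<in> carrier_vec k" "h' \<in> carrier_vec k" and "\<And>x. x \<in> carrier_vec k \<Longrightarrow> x \<bullet> h = x \<bullet> h'"
  shows "h = h'"
proof (rule eq_vecI)
  show "h $ i = h' $ i" if "i < dim_vec h'" for i
    using assms(3)[of "unit_vec k i"] assms(1,2) that by simp
qed (use assms in simp)

lemma cyclic_right_submodule_unit_multiple:
  assumes "u \<in> ring_units"
  shows "cyclic_right_submodule (right_smult_vec g u) = cyclic_right_submodule g"
proof -
  obtain v where v: "u * v = 1" using assms by (auto simp: ring_units_def)
  show ?thesis
  proof
    show "cyclic_right_submodule (right_smult_vec g u) \<subseteq> cyclic_right_submodule g"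
      by (auto simp: cyclic_right_submodule_def right_smult_vec_assoc)
    have "right_smult_vec g a = right_smult_vec (right_smult_vec g u) (v * a)" for a
      by (simp add: right_smult_vec_assoc mult.assoc[symmetric] v)
    then show "cyclic_right_submodule g \<subseteq> cyclic_right_submodule (right_smult_vec g u)"
      unfolding cyclic_right_submodule_def by (metis image_subsetI rangeI)
  qed
qed

text \<open>The columns of a generator matrix and their unit multiples give characters of the code, and by
  modularity each of them occurs \<open>r\<close> times the number of units. A vector \<open>y\<close> in \<open>Y\<close> stands for the
  character \<open>c \<mapsto> \<chi> (c \<bullet> y)\<close>.\<close>

lemma modular_code_characters:
  fixes C :: "'a::{ring_1,finite} vec set"
  assumes frobenius: "frobenius_ring TYPE('a)" and modular: "modular_code n C r"
  shows "\<exists>Y \<subseteq> carrier_vec n. (\<forall>y\<in>Y. \<exists>c\<in>C. c \<bullet> y \<noteq> 0) \<and>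
    (\<forall>y\<in>Y. \<forall>y'\<in>Y. (\<forall>c\<in>C. c \<bullet> y = c \<bullet> y') \<longrightarrow> y = y') \<and>
    (\<forall>c\<in>C. complex_of_real (hom_weight_vec c) = of_nat n - of_real r * (\<Sum>y\<in>Y. gen_char (c \<bullet> y)))"
proof -
  obtain k G where G: "G \<in> carrier_mat k n" and C: "C = {vec_mult_mat x G | x. x \<in> carrier_vec k}"
    and points: "\<And>g. g \<in> carrier_vec k \<Longrightarrow> g \<noteq> 0\<^sub>v k \<Longrightarrow>
      point_multiplicity G (cyclic_right_submodule g) = 0 \<or>
      real (point_multiplicity G (cyclic_right_submodule g)) =
        r * real (card (right_smult_vec g ` ring_units))"
    and full: "\<And>j. j < n \<Longrightarrow> \<exists>c\<in>C. c $ j \<noteq> 0"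
    using modular unfolding modular_code_def by blast
  define U where "U = (ring_units :: 'a set)"
  have U_pos: "card U > 0" unfolding U_def by (rule card_ring_units_pos[OF frobenius])
  have col: "col G j \<in> carrier_vec k" if "j < n" for j using G that by auto
  have word: "vec_mult_mat x G $ j = x \<bullet> col G j" if "j < n" for x j
    using G that by (simp add: vec_mult_mat_def)
  have word_dim: "dim_vec (vec_mult_mat x G) = n" for x
    using G by (simp add: vec_mult_mat_def)
  \<comment> \<open>\<open>\<phi>\<close> lists the unit multiples of columns in R^k. Since
    \<open>c \<bullet> e (j, u)\<close> is the \<open>j\<close>-th coordinate of \<open>c\<close>
    times \<open>u\<close>, \<open>e\<close> realises the same functional on \<open>C\<close> by a
    vector of R^n, which removes \<open>k\<close> and \<open>G\<close> from the conclusion;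
    \<open>\<rho>\<close> picks one pair for each value of \<open>\<phi>\<close>.\<close>
  define \<phi> where "\<phi> = (\<lambda>(j, u). right_smult_vec (col G j) u)"
  define e where "e = (\<lambda>(j, u). right_smult_vec (unit_vec n j) (u::'a))"
  define H where "H = \<phi> ` ({..<n} \<times> U)"
  define \<rho> where "\<rho> h = (SOME p. p \<in> {..<n} \<times> U \<and> \<phi> p = h)" for h
  have \<rho>: "\<rho> h \<in> {..<n} \<times> U \<and> \<phi> (\<rho> h) = h" if "h \<in> H" for h
    unfolding \<rho>_def by (rule someI_ex) (use that in \<open>auto simp: H_def\<close>)
  have e_prod: "vec_mult_mat x G \<bullet> e p = x \<bullet> \<phi> p" if x: "x \<in> carrier_vec k" and "p \<in> {..<n} \<times> U" for x p
  proof -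
    from \<open>p \<in> {..<n} \<times> U\<close> obtain j u where p: "p = (j, u)" "j < n" by auto
    have "vec_mult_mat x G \<bullet> e p = vec_mult_mat x G $ j * u"
      using p scalar_prod_right_smult[OF carrier_vecI[OF word_dim[of x]] unit_vec_carrier, of j u]
        carrier_vecI[OF word_dim[of x]]
      by (simp add: e_def scalar_prod_right_unit)
    also have "\<dots> = x \<bullet> \<phi> p"
      using p by (simp add: word \<phi>_def scalar_prod_right_smult[OF x col])
    finally show ?thesis .
  qed
  have H_carrier: "H \<subseteq> carrier_vec k"
    using col by (auto simp: H_def \<phi>_def right_smult_vec_carrier)
  define Y where "Y = (\<lambda>h. e (\<rho> h)) ` H"
  have Y_prod: "vec_mult_mat x G \<bullet> e (\<rho> h) = x \<bullet> h" if "x \<in> carrier_vec k" "h \<in> H" for x h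
    using e_prod[OF that(1)] \<rho>[OF that(2)] by metis
  have sep: "h = h'" if h: "h \<in> H" "h' \<in> H" and eq: "\<forall>c\<in>C. c \<bullet> e (\<rho> h) = c \<bullet> e (\<rho> h')" for h h'
  proof (rule scalar_prod_nondegenerate[of _ k])
    show "x \<bullet> h = x \<bullet> h'" if "x \<in> carrier_vec k" for x
    proof -
      have "vec_mult_mat x G \<in> C" using C that by blast
      then show ?thesis using eq Y_prod[OF that] h by metis
    qed
  qed (use h H_carrier in auto)
  have inj: "inj_on (\<lambda>h. e (\<rho> h)) H"
    by (rule inj_onI) (simp add: sep)
  have H_zero: "h \<noteq> 0\<^sub>v k" if h: "h \<in> H" for h
  proof
    assume h0: "h = 0\<^sub>v k"
    obtain j u where ju: "j < n" "u \<in> ring_units" "h = right_smult_vec (col G j) u"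
      using h by (auto simp: H_def \<phi>_def U_def)
    obtain c where "c \<in> C" "c $ j \<noteq> 0" using full[OF ju(1)] by auto
    then obtain x where x: "x \<in> carrier_vec k" "x \<bullet> col G j \<noteq> 0" using C word[OF ju(1)] by auto
    obtain v where v: "u * v = 1" using ju(2) by (auto simp: ring_units_def)
    have "(x \<bullet> col G j) * u = x \<bullet> h"
      by (simp add: ju(3) scalar_prod_right_smult[OF x(1) col[OF ju(1)]])
    also have "\<dots> = 0" using x(1) h0 by simp
    finally have "(x \<bullet> col G j) * u * v = 0" by simp
    with x(2) v show False by (simp add: mult.assoc)
  qed
  \<comment> \<open>Pairs over \<open>h\<close> come from the columns that generate the module of
    \<open>h\<close>. Each such column is a unit multiple of \<open>h\<close> and contributes
    \<open>card U\<close> divided by the orbit size; modularity gives \<open>r\<close> times the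
    orbit size for the number of columns.\<close>
  have count: "real (card {p \<in> {..<n} \<times> U. \<phi> p = h}) = r * real (card U)" if h: "h \<in> H" for h
  proof -
    define J where "J = {j. j < dim_col G \<and> cyclic_right_submodule (col G j) = cyclic_right_submodule h}"
    have J: "j \<in> J \<longleftrightarrow> j < n \<and> cyclic_right_submodule (col G j) = cyclic_right_submodule h" for j
      using G by (auto simp: J_def)
    have "finite J" by (simp add: J_def)
    have "{p \<in> {..<n} \<times> U. \<phi> p = h} = Sigma J (\<lambda>j. {u \<in> U. right_smult_vec (col G j) u = h})"
      by (auto simp: \<phi>_def J U_def cyclic_right_submodule_unit_multiple)
    then have "real (card {p \<in> {..<n} \<times> U. \<phi> p = h}) =
        (\<Sum>j\<in>J. real (card {u \<in> U. right_smult_vec (col G j) u = h}))"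
      using \<open>finite J\<close> by simp
    also have "\<dots> = (\<Sum>j\<in>J. real (card U) / real (card (right_smult_vec h ` U)))"
    proof (intro sum.cong refl)
      fix j assume "j \<in> J"
      then have j: "j < n" "cyclic_right_submodule (col G j) = cyclic_right_submodule h" by (auto simp: J)
      obtain u where u: "u \<in> ring_units" "h = right_smult_vec (col G j) u"
        using cyclic_generators_unit_multiple[OF col[OF j(1)] j(2)] by auto
      obtain v where v: "u * v = 1" "v * u = 1" using u(1) by (auto simp: ring_units_def)
      have "right_smult_vec h ` ring_units = right_smult_vec (col G j) ` ((\<lambda>w. u * w) ` ring_units)"
        by (simp add: u(2) right_smult_vec_assoc image_image)
      also have "(\<lambda>w. u * w) ` ring_units = ring_units"
      proof (intro equalityI subsetI)
        fix w assume "w \<in> (\<lambda>w. u * w) ` ring_units"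
        then obtain w' where "w = u * w'" "w' \<in> ring_units" by auto
        then show "w \<in> ring_units"
          using bij_betw_mult_right_units[of w'] u(1) by (auto simp: bij_betw_def)
      next
        fix w :: 'a assume w: "w \<in> ring_units"
        have "v \<in> ring_units" using v by (auto simp: ring_units_def)
        then have "v * w \<in> ring_units"
          using bij_betw_mult_right_units[OF w] by (auto simp: bij_betw_def)
        moreover have "w = u * (v * w)" by (simp add: mult.assoc[symmetric] v)
        ultimately show "w \<in> (\<lambda>w. u * w) ` ring_units" by blast
      qed
      finally have orbit: "right_smult_vec h ` U = right_smult_vec (col G j) ` U" by (simp add: U_def)
      have "card {u \<in> U. right_smult_vec (col G j) u = h} * card (right_smult_vec (col G j) ` U) = card U"
        unfolding U_def by (rule card_unit_fibre) (use u in blast)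
      then have "real (card {u \<in> U. right_smult_vec (col G j) u = h}) * real (card (right_smult_vec h ` U)) = real (card U)"
        by (simp only: orbit of_nat_mult[symmetric])
      moreover have "real (card (right_smult_vec h ` U)) \<noteq> 0" using U_pos by (auto simp: card_gt_0_iff)
      ultimately show "real (card {u \<in> U. right_smult_vec (col G j) u = h}) =
          real (card U) / real (card (right_smult_vec h ` U))"
        by (simp add: nonzero_eq_divide_eq)
    qed
    also have "\<dots> = real (card J) * real (card U) / real (card (right_smult_vec h ` U))" by simp
    also have "real (card J) = r * real (card (right_smult_vec h ` U))"
    proof -
      obtain j u where "j < n" "u \<in> ring_units" "h = right_smult_vec (col G j) u"
        using h by (auto simp: H_def \<phi>_def U_def)
      then have "j \<in> J" by (simp add: J cyclic_right_submodule_unit_multiple)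
      then have "card J \<noteq> 0" using \<open>finite J\<close> by auto
      moreover have "point_multiplicity G (cyclic_right_submodule h) = card J"
        by (simp add: point_multiplicity_def J_def)
      ultimately show ?thesis
        using points[of h] H_zero[OF h] H_carrier h by (auto simp: U_def)
    qed
    also have "r * real (card (right_smult_vec h ` U)) * real (card U) / real (card (right_smult_vec h ` U))
        = r * real (card U)"
      using U_pos by (auto simp: card_gt_0_iff)
    finally show ?thesis .
  qed
  \<comment> \<open>The coordinate weights are expanded over the units and the pairs grouped by
    \<open>h\<close>; the multiplicity \<open>r * card U\<close> cancels the normalising factor of
    the weight.\<close>
  have weight: "complex_of_real (hom_weight_vec c) = of_nat n - of_real r * (\<Sum>y\<in>Y. gen_char (c \<bullet> y))"
    if c: "c \<in> C" for c
  proof -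
    obtain x where x: "x \<in> carrier_vec k" "c = vec_mult_mat x G" using c C by auto
    have "complex_of_real (hom_weight_vec c) = (\<Sum>j<n. complex_of_real (hom_weight (x \<bullet> col G j)))"
      by (simp add: hom_weight_vec_def x(2) word_dim word)
    also have "\<dots> = (\<Sum>j<n. 1 - (\<Sum>u\<in>U. gen_char (x \<bullet> \<phi> (j, u))) / of_nat (card U))"
      by (intro sum.cong refl)
        (simp add: hom_weight_eq_right[OF frobenius] \<phi>_def U_def scalar_prod_right_smult[OF x(1) col])
    also have "\<dots> = of_nat n - (\<Sum>j<n. \<Sum>u\<in>U. gen_char (x \<bullet> \<phi> (j, u))) / of_nat (card U)"
      by (simp add: sum_subtractf sum_divide_distrib)
    also have "(\<Sum>j<n. \<Sum>u\<in>U. gen_char (x \<bullet> \<phi> (j, u))) = (\<Sum>p\<in>{..<n} \<times> U. gen_char (x \<bullet> \<phi> p))"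
      by (simp add: sum.cartesian_product)
    also have "\<dots> = (\<Sum>h\<in>H. \<Sum>p\<in>{p \<in> {..<n} \<times> U. \<phi> p = h}. gen_char (x \<bullet> \<phi> p))"
      unfolding H_def by (rule sum.image_gen) (simp add: U_def)
    also have "\<dots> = (\<Sum>h\<in>H. of_real (r * real (card U)) * gen_char (x \<bullet> h))"
    proof (intro sum.cong refl)
      fix h assume h: "h \<in> H"
      have "(\<Sum>p\<in>{p \<in> {..<n} \<times> U. \<phi> p = h}. gen_char (x \<bullet> \<phi> p)) =
          complex_of_real (real (card {p \<in> {..<n} \<times> U. \<phi> p = h})) * gen_char (x \<bullet> h)"
        by simp
      then show "(\<Sum>p\<in>{p \<in> {..<n} \<times> U. \<phi> p = h}. gen_char (x \<bullet> \<phi> p)) =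
          of_real (r * real (card U)) * gen_char (x \<bullet> h)"
        by (simp only: count[OF h])
    qed
    also have "\<dots> = of_real (r * real (card U)) * (\<Sum>h\<in>H. gen_char (x \<bullet> h))"
      by (simp only: sum_distrib_left)
    also have "(\<Sum>h\<in>H. gen_char (x \<bullet> h)) = (\<Sum>h\<in>H. gen_char (c \<bullet> e (\<rho> h)))"
      using Y_prod[OF x(1)] by (simp add: x(2))
    also have "\<dots> = (\<Sum>y\<in>Y. gen_char (c \<bullet> y))"
      unfolding Y_def by (simp add: sum.reindex[OF inj])
    finally show ?thesis using U_pos by (simp add: card_gt_0_iff)
  qed
  show ?thesis
  proof (intro exI[of _ Y] conjI ballI impI)
    show "Y \<subseteq> carrier_vec n"
      using \<rho> by (auto simp: Y_def e_def right_smult_vec_carrier split: prod.split)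
    show "\<exists>c\<in>C. c \<bullet> y \<noteq> 0" if y: "y \<in> Y" for y
    proof (rule ccontr)
      obtain h where h: "h \<in> H" "y = e (\<rho> h)" using y by (auto simp: Y_def)
      assume zero: "\<not> (\<exists>c\<in>C. c \<bullet> y \<noteq> 0)"
      have "h = 0\<^sub>v k"
      proof (rule scalar_prod_nondegenerate[of _ k])
        show "x \<bullet> h = x \<bullet> 0\<^sub>v k" if "x \<in> carrier_vec k" for x
        proof -
          have "vec_mult_mat x G \<in> C" using C that by blast
          then have "vec_mult_mat x G \<bullet> y = 0" using zero by blast
          then show ?thesis using Y_prod[OF that h(1)] h(2) that by simp
        qed
      qed (use h H_carrier in auto)
      with H_zero[OF h(1)] show False by simp
    qed
    show "y = y'" if "y \<in> Y" "y' \<in> Y" "\<forall>c\<in>C. c \<bullet> y = c \<bullet> y'" for y y'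
      using that sep unfolding Y_def by blast
  qed (use weight in auto)
qed

section \<open>The dual of a two-weight code\<close>

lemma right_span_cols:
  fixes M :: "'a::ring_1 mat"
  assumes M: "M \<in> carrier_mat b n"
  shows "right_span b (set (cols M)) = {M *\<^sub>v y | y. y \<in> carrier_vec n}"
proof
  let ?R = "{M *\<^sub>v y | y. y \<in> carrier_vec n}"
  have "right_linear_code b ?R"
    unfolding right_linear_code_def
  proof (intro conjI ballI allI)
    show "?R \<subseteq> carrier_vec b" using M by auto
    show "0\<^sub>v b \<in> ?R"
      using M by (auto intro!: exI[of _ "0\<^sub>v n"])
    show "x + y \<in> ?R" if xy: "x \<in> ?R" "y \<in> ?R" for x y
    proof -
      obtain a c where "x = M *\<^sub>v a" "y = M *\<^sub>v c" "a \<in> carrier_vec n" "c \<in> carrier_vec n"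
        using xy by auto
      then show ?thesis
        using M by (auto intro!: exI[of _ "a + c"] simp: mult_add_distrib_mat_vec)
    qed
    show "right_smult_vec x a \<in> ?R" if x: "x \<in> ?R" for x a
    proof -
      obtain c where c: "x = M *\<^sub>v c" "c \<in> carrier_vec n" using x by auto
      have "right_smult_vec x a = M *\<^sub>v right_smult_vec c a"
        using M c by (intro eq_vecI) (auto simp: right_smult_vec_def scalar_prod_def sum_distrib_right mult.assoc)
      then show ?thesis using right_smult_vec_carrier[OF c(2)] by blast
    qed
  qed
  moreover have "set (cols M) \<subseteq> ?R"
  proof
    fix v assume "v \<in> set (cols M)"
    then obtain j where j: "j < n" "v = col M j" using M by (auto simp: cols_def)
    then have "v = M *\<^sub>v unit_vec n j"
      using M by (intro eq_vecI) (auto simp: scalar_prod_right_unit)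
    then show "v \<in> ?R" using unit_vec_carrier by blast
  qed
  ultimately show "right_span b (set (cols M)) \<subseteq> ?R"
    unfolding right_span_def by blast
  show "?R \<subseteq> right_span b (set (cols M))"
    unfolding right_span_def
  proof (intro subsetI InterI)
    fix v D assume "v \<in> ?R" and D: "D \<in> {D. right_linear_code b D \<and> set (cols M) \<subseteq> D}"
    then obtain y where y: "y \<in> carrier_vec n" "v = M *\<^sub>v y" by auto
    \<comment> \<open>\<open>D\<close> is only known to be closed under binary sums and scalars, so
      \<open>M *\<^sub>v y\<close> is built up column by column.\<close>
    have partial: "vec b (\<lambda>i. \<Sum>j<k. M $$ (i, j) * y $ j) \<in> D" if "k \<le> n" for k
      using that
    proof (induction k)
      case 0
      have "vec b (\<lambda>i. \<Sum>j<0. M $$ (i, j) * y $ j) = 0\<^sub>v b" by (intro eq_vecI) auto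
      then show ?case using D by (simp add: right_linear_code_def)
    next
      case (Suc k)
      have "col M k \<in> D" using D Suc.prems M by (auto simp: cols_def)
      then have "right_smult_vec (col M k) (y $ k) \<in> D"
        using D by (auto simp: right_linear_code_def)
      moreover have "vec b (\<lambda>i. \<Sum>j<k. M $$ (i, j) * y $ j) \<in> D"
        using Suc by simp
      ultimately have "vec b (\<lambda>i. \<Sum>j<k. M $$ (i, j) * y $ j) + right_smult_vec (col M k) (y $ k) \<in> D"
        using D by (auto simp: right_linear_code_def)
      also have "vec b (\<lambda>i. \<Sum>j<k. M $$ (i, j) * y $ j) + right_smult_vec (col M k) (y $ k) =
          vec b (\<lambda>i. \<Sum>j<Suc k. M $$ (i, j) * y $ j)"
        using M Suc.prems by (intro eq_vecI) (auto simp: right_smult_vec_def)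
      finally show ?case .
    qed
    have "v = vec b (\<lambda>i. \<Sum>j<n. M $$ (i, j) * y $ j)"
      using y M by (intro eq_vecI) (auto simp: scalar_prod_def atLeast0LessThan)
    then show "v \<in> D" using partial[of n] by simp
  qed
qed

text \<open>This is the equality case of the triangle inequality: numbers of modulus 1 whose real
  parts average to 1 are all equal to 1, and the unit 1 contributes \<open>gen_char x\<close>
  itself.\<close>

lemma gen_char_eq_one_of_hom_weight_zero:
  assumes frobenius: "frobenius_ring TYPE('a::{ring_1,finite})" and "hom_weight (x::'a) = 0"
  shows "gen_char x = 1"
proof -
  have "(\<Sum>u\<in>ring_units. gen_char (u * x)) = of_nat (card (ring_units :: 'a set))"
    using hom_weight_eq[OF frobenius, of x] assms(2) card_ring_units_pos[OF frobenius] by simp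
  from arg_cong[OF this, of Re]
  have sum: "(\<Sum>u\<in>ring_units. 1 - Re (gen_char (u * x))) = 0"
    by (simp add: sum_subtractf)
  have le: "Re (gen_char y) \<le> 1" for y :: 'a
    using complex_Re_le_cmod[of "gen_char y"] norm_gen_char[OF frobenius, of y] by simp
  have "\<forall>u\<in>ring_units. 1 - Re (gen_char (u * x)) = 0"
    using sum by (subst (asm) sum_nonneg_eq_0_iff) (auto simp: le)
  then have Re: "Re (gen_char x) = 1" using one_ring_units by force
  have "(Re (gen_char x))\<^sup>2 + (Im (gen_char x))\<^sup>2 = 1"
    using norm_gen_char[OF frobenius, of x] by (metis cmod_power2 one_power2)
  with Re show ?thesis by (simp add: complex_eq_iff)
qed

section \<open>A modular two-weight code, seen through the characters given by
  \<open>Y\<close>\<close>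

locale modular_two_weight =
  fixes n :: nat and C :: "'a::{ring_1,finite} vec set" and r w1 w2 :: real and Y :: "'a vec set"
  assumes frobenius: "frobenius_ring TYPE('a)"
    and linear: "left_linear_code n C"
    and weights: "w1 < w2" "nonzero_weights C = {w1, w2}"
    and zero_words: "words_of_weight C 0 = {0\<^sub>v n}"
    and Y_carrier: "Y \<subseteq> carrier_vec n"
    and Y_nonzero: "\<And>y. y \<in> Y \<Longrightarrow> \<exists>c\<in>C. c \<bullet> y \<noteq> 0"
    and Y_distinct: "\<And>y y'. y \<in> Y \<Longrightarrow> y' \<in> Y \<Longrightarrow> (\<forall>c\<in>C. c \<bullet> y = c \<bullet> y') \<Longrightarrow> y = y'"
    and weight_Y: "\<And>c. c \<in> C \<Longrightarrow>
      complex_of_real (hom_weight_vec c) = of_nat n - of_real r * (\<Sum>y\<in>Y. gen_char (c \<bullet> y))"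
begin

lemma C_carrier: "C \<subseteq> carrier_vec n"
  and C_zero: "0\<^sub>v n \<in> C"
  and C_add: "x \<in> C \<Longrightarrow> y \<in> C \<Longrightarrow> x + y \<in> C"
  and C_smult: "x \<in> C \<Longrightarrow> a \<cdot>\<^sub>v x \<in> C"
  using linear by (auto simp: left_linear_code_def)

lemma C_dim: "c \<in> C \<Longrightarrow> c \<in> carrier_vec n"
  using C_carrier by auto

lemma C_uminus: "x \<in> C \<Longrightarrow> - x \<in> C"
proof -
  assume x: "x \<in> C"
  have "- x = (- 1) \<cdot>\<^sub>v x" by (intro eq_vecI) auto
  then show ?thesis using C_smult[OF x, of "- 1"] by simp
qed

lemma C_finite: "finite C"
  using C_carrier finite_carrier_vec by (rule finite_subset)

lemma Y_finite: "finite Y"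
  using Y_carrier finite_carrier_vec by (rule finite_subset)

lemma card_C_pos: "card C > 0"
  using C_finite C_zero by (auto simp: card_gt_0_iff)

abbreviation C1 :: "'a vec set" where "C1 \<equiv> words_of_weight C w1"

lemma smaller: "smaller_weight C = w1"
  using weights by (simp add: smaller_weight_def)

lemma C1_finite: "finite C1"
  using C_finite by (simp add: words_of_weight_def)

lemma C1_subset: "C1 \<subseteq> C"
  by (auto simp: words_of_weight_def)

lemma weights_nonzero: "w1 \<noteq> 0" "w2 \<noteq> 0"
  using weights(2) by (auto simp: nonzero_weights_def)

lemma word_exists: "\<exists>c\<in>C. hom_weight_vec c = w1" "\<exists>c\<in>C. hom_weight_vec c = w2"
proof -
  have "w1 \<in> hom_weight_vec ` C" "w2 \<in> hom_weight_vec ` C"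
    using weights(2) by (auto simp: nonzero_weights_def)
  then show "\<exists>c\<in>C. hom_weight_vec c = w1" "\<exists>c\<in>C. hom_weight_vec c = w2" by auto
qed

lemma weight_cases: "c \<in> C \<Longrightarrow> c = 0\<^sub>v n \<or> hom_weight_vec c = w1 \<or> hom_weight_vec c = w2"
proof -
  assume c: "c \<in> C"
  show ?thesis
  proof (cases "hom_weight_vec c = 0")
    case True
    then have "c \<in> words_of_weight C 0" using c by (simp add: words_of_weight_def)
    then show ?thesis using zero_words by simp
  next
    case False
    then have "hom_weight_vec c \<in> nonzero_weights C" using c by (simp add: nonzero_weights_def)
    then show ?thesis using weights(2) by simp
  qed
qed

lemma weight_zero: "hom_weight_vec (0\<^sub>v n :: 'a vec) = 0"
  by (simp add: hom_weight_vec_def hom_weight_zero[OF frobenius])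

lemma C1_nonzero: "c \<in> C1 \<Longrightarrow> c \<noteq> 0\<^sub>v n"
  using weight_zero weights_nonzero by (auto simp: words_of_weight_def)

text \<open>The weight formula at the zero word. It also yields the sign of \<open>r\<close>, since
  a nonzero weight forces \<open>n > 0\<close>.\<close>

lemma length_eq: "real n = r * real (card Y)"
proof -
  have "gen_char (0\<^sub>v n \<bullet> y) = 1" if "y \<in> Y" for y
    using that Y_carrier by (auto simp: gen_char_zero[OF frobenius])
  then have "complex_of_real (real n) = complex_of_real (r * real (card Y))"
    using weight_Y[OF C_zero] by (simp add: weight_zero)
  then show ?thesis by (simp only: of_real_eq_iff)
qed

lemma length_pos: "n > 0"
proof (rule ccontr)
  assume "\<not> n > 0"
  obtain c where c: "c \<in> C" "hom_weight_vec c = w1" using word_exists(1) by auto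
  then have "dim_vec c = 0" using C_dim[OF c(1)] \<open>\<not> n > 0\<close> by auto
  then have "hom_weight_vec c = 0" by (simp add: hom_weight_vec_def)
  with c weights_nonzero show False by simp
qed

lemma r_pos: "r > 0"
proof (rule ccontr)
  assume "\<not> r > 0"
  then have "r * real (card Y) \<le> 0" by (simp add: mult_nonpos_nonneg)
  then show False using length_eq length_pos by simp
qed

lemma Y_nonempty: "Y \<noteq> {}"
  using length_eq length_pos by auto

text \<open>The vectors that give the trivial character of \<open>C\<close>: vectors that differ by
  an element of \<open>perp\<close> give the same character.\<close>

definition perp :: "'a vec set" where
  "perp = {y \<in> carrier_vec n. \<forall>c\<in>C. c \<bullet> y = 0}"

lemma character_sum:
  assumes y: "y \<in> carrier_vec n"
  shows "(\<Sum>c\<in>C. gen_char (c \<bullet> y)) = (if y \<in> perp then of_nat (card C) else 0)"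
proof (cases "y \<in> perp")
  case True
  then show ?thesis by (simp add: perp_def gen_char_zero[OF frobenius])
next
  case False
  then obtain c where c: "c \<in> C" "c \<bullet> y \<noteq> 0" using y by (auto simp: perp_def)
  \<comment> \<open>\<open>gen_char\<close> may be 1 at \<open>c \<bullet> y\<close> itself; left
    linearity allows \<open>c\<close> to be replaced by a multiple where it is not.\<close>
  then obtain a where a: "gen_char (a * (c \<bullet> y)) \<noteq> 1"
    using generating_character_nondegenerate(1)[OF generating_gen_char[OF frobenius]] by blast
  define c0 where "c0 = a \<cdot>\<^sub>v c"
  have c0: "c0 \<in> C" using c by (simp add: c0_def C_smult)
  have "c0 \<bullet> y = a * (c \<bullet> y)" using C_dim[OF c(1)] y by (simp add: c0_def)
  with a have c0_y: "gen_char (c0 \<bullet> y) \<noteq> 1" by simp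
  have "bij_betw (\<lambda>c. c0 + c) C C"
  proof (rule bij_betwI[where g = "\<lambda>c. - c0 + c"])
    show "- c0 + (c0 + c) = c" "c0 + (- c0 + c) = c" if "c \<in> C" for c
      using C_dim[OF that] C_dim[OF c0] by (auto intro!: eq_vecI)
  qed (use c0 C_add C_uminus in auto)
  then have "(\<Sum>c\<in>C. gen_char (c \<bullet> y)) = 0"
    by (rule sum_eq_zero_by_shift[OF _ _ c0_y])
      (use C_dim C_dim[OF c0] y in \<open>simp add: add_scalar_prod_distrib gen_char_add[OF frobenius]\<close>)
  with False show ?thesis by simp
qed

definition transform :: "'a vec \<Rightarrow> complex" where
  "transform y = (\<Sum>c\<in>C1. gen_char (c \<bullet> y))"

text \<open>Says that the character of \<open>y\<close> belongs to the set \<Psi> of characters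
  given by \<open>Y\<close>.\<close>

definition represented :: "'a vec \<Rightarrow> bool" where
  "represented y \<longleftrightarrow> (\<exists>y'\<in>Y. y' - y \<in> perp)"

lemma sum_uminus:
  assumes "A = C \<or> A = C1" and y: "y \<in> carrier_vec n"
  shows "(\<Sum>c\<in>A. gen_char (- (c \<bullet> y))) = (\<Sum>c\<in>A. gen_char (c \<bullet> y))"
proof -
  have A: "A \<subseteq> C" using assms(1) C1_subset by auto
  have "bij_betw uminus A A"
    using assms(1) C_uminus
    by (intro bij_betwI[where g = uminus]) (auto simp: words_of_weight_def hom_weight_vec_uminus[OF frobenius])
  then have "(\<Sum>c\<in>A. gen_char ((- c) \<bullet> y)) = (\<Sum>c\<in>A. gen_char (c \<bullet> y))"
    by (rule sum.reindex_bij_betw)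
  moreover have "(- c) \<bullet> y = - (c \<bullet> y)" if "c \<in> A" for c
    using that A C_dim[of c] y by (intro scalar_prod_uminus_left) auto
  ultimately show ?thesis by simp
qed

text \<open>\<open>A\<close>, a Fourier coefficient of the weight function, is computed twice. By
  values, the weight is \<open>w2\<close>, less \<open>w2\<close> at the zero word and less
  \<open>w2 - w1\<close> on \<open>C1\<close>, which brings in the transform. By
  \<open>weight_Y\<close>, orthogonality leaves only the indicators of \<open>perp\<close> and
  \<open>represented\<close>.\<close>

lemma transform_eq:
  assumes y: "y \<in> carrier_vec n"
  shows "of_real (w2 - w1) * transform y = complex_of_real
    (real (card C) * (w2 - real n) * of_bool (y \<in> perp) - w2 + r * real (card C) * of_bool (represented y))"
proof -
  define A where "A = (\<Sum>c\<in>C. of_real (hom_weight_vec c) * gen_char (- (c \<bullet> y)))"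
  have E: "(\<Sum>c\<in>C. gen_char (- (c \<bullet> y))) = of_nat (card C) * of_bool (y \<in> perp)"
    by (simp add: sum_uminus[OF _ y] character_sum[OF y])
  have "A = (\<Sum>c\<in>C. of_real w2 * gen_char (- (c \<bullet> y)) - (if c = 0\<^sub>v n then of_real w2 else 0)
      - (if c \<in> C1 then of_real (w2 - w1) * gen_char (- (c \<bullet> y)) else 0))"
    unfolding A_def
  proof (intro sum.cong refl)
    fix c assume c: "c \<in> C"
    consider "c = 0\<^sub>v n" | "c \<noteq> 0\<^sub>v n" "hom_weight_vec c = w1" | "c \<noteq> 0\<^sub>v n" "hom_weight_vec c = w2"
      using weight_cases[OF c] by blast
    then show "of_real (hom_weight_vec c) * gen_char (- (c \<bullet> y)) =
        of_real w2 * gen_char (- (c \<bullet> y)) - (if c = 0\<^sub>v n then of_real w2 else 0)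
        - (if c \<in> C1 then of_real (w2 - w1) * gen_char (- (c \<bullet> y)) else 0)"
    proof cases
      case 1
      then show ?thesis
        using C1_nonzero[of c] y by (auto simp: weight_zero gen_char_zero[OF frobenius])
    next
      case 2
      then show ?thesis using c by (simp add: words_of_weight_def algebra_simps)
    next
      case 3
      then show ?thesis using c weights(1) by (simp add: words_of_weight_def)
    qed
  qed
  also have "\<dots> = of_real w2 * (\<Sum>c\<in>C. gen_char (- (c \<bullet> y))) - of_real w2
      - of_real (w2 - w1) * (\<Sum>c\<in>C1. gen_char (- (c \<bullet> y)))"
  proof -
    have "(\<Sum>c\<in>C. if c \<in> C1 then of_real (w2 - w1) * gen_char (- (c \<bullet> y)) else 0) =
        (\<Sum>c\<in>C1. of_real (w2 - w1) * gen_char (- (c \<bullet> y)))"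
      using C_finite C1_subset by (simp add: sum.inter_restrict[symmetric] Int_absorb1)
    moreover have "(\<Sum>c\<in>C. if c = 0\<^sub>v n then of_real w2 else 0) = complex_of_real w2"
      using C_finite C_zero by simp
    ultimately show ?thesis by (simp only: sum_subtractf sum_distrib_left)
  qed
  finally have A1: "A = of_real w2 * (of_nat (card C) * of_bool (y \<in> perp)) - of_real w2 - of_real (w2 - w1) * transform y"
    by (simp only: E transform_def sum_uminus[OF disjI2[OF refl] y])
  have "A = (\<Sum>c\<in>C. of_nat n * gen_char (- (c \<bullet> y)) - of_real r * (\<Sum>y'\<in>Y. gen_char (c \<bullet> (y' - y))))"
    unfolding A_def
  proof (intro sum.cong refl)
    fix c assume c: "c \<in> C"
    have "gen_char (c \<bullet> (y' - y)) = gen_char (c \<bullet> y') * gen_char (- (c \<bullet> y))" if "y' \<in> Y" for y'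
    proof -
      have "c \<bullet> (y' - y) = c \<bullet> y' + - (c \<bullet> y)"
        using scalar_prod_minus_distrib[of c n y' y] C_dim[OF c] Y_carrier that y by auto
      then show ?thesis by (simp only: gen_char_add[OF frobenius])
    qed
    then have "(\<Sum>y'\<in>Y. gen_char (c \<bullet> (y' - y))) = (\<Sum>y'\<in>Y. gen_char (c \<bullet> y')) * gen_char (- (c \<bullet> y))"
      by (simp add: sum_distrib_right)
    then show "of_real (hom_weight_vec c) * gen_char (- (c \<bullet> y)) =
        of_nat n * gen_char (- (c \<bullet> y)) - of_real r * (\<Sum>y'\<in>Y. gen_char (c \<bullet> (y' - y)))"
      by (simp add: weight_Y[OF c] algebra_simps)
  qed
  also have "\<dots> = of_nat n * (\<Sum>c\<in>C. gen_char (- (c \<bullet> y)))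
      - of_real r * (\<Sum>y'\<in>Y. \<Sum>c\<in>C. gen_char (c \<bullet> (y' - y)))"
    by (simp only: sum_subtractf sum_distrib_left[symmetric] sum.swap[of _ Y C])
  also have "(\<Sum>y'\<in>Y. \<Sum>c\<in>C. gen_char (c \<bullet> (y' - y))) = of_nat (card C) * of_bool (represented y)"
  proof -
    have "(\<Sum>y'\<in>Y. \<Sum>c\<in>C. gen_char (c \<bullet> (y' - y))) =
        (\<Sum>y'\<in>Y. if y' - y \<in> perp then of_nat (card C) else 0)"
      using y Y_carrier by (intro sum.cong refl character_sum) auto
    also have "\<dots> = of_nat (card C) * of_nat (card {y' \<in> Y. y' - y \<in> perp})"
      using Y_finite by (simp add: sum.If_cases Int_def mult.commute)
    \<comment> \<open>\<open>Y_distinct\<close> excludes two members of \<open>Y\<close> with the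
      same character, so the count is 0 or 1.\<close>
    also have "card {y' \<in> Y. y' - y \<in> perp} = of_bool (represented y)"
    proof (cases "represented y")
      case True
      then obtain y0 where y0: "y0 \<in> Y" "y0 - y \<in> perp" by (auto simp: represented_def)
      have "y' = y0" if y': "y' \<in> Y" "y' - y \<in> perp" for y'
      proof (rule Y_distinct[OF y'(1) y0(1)], rule ballI)
        fix c assume c: "c \<in> C"
        have "c \<bullet> (z - y) = c \<bullet> z - c \<bullet> y" if "z \<in> Y" for z
          using scalar_prod_minus_distrib[of c n z y] C_dim[OF c] Y_carrier that y by auto
        moreover have "c \<bullet> (y' - y) = 0" "c \<bullet> (y0 - y) = 0" using y' y0 c by (auto simp: perp_def)
        ultimately show "c \<bullet> y' = c \<bullet> y0" using y' y0 by simp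
      qed
      then have "{y' \<in> Y. y' - y \<in> perp} = {y0}" using y0 by blast
      then show ?thesis using True by simp
    next
      case False
      then have "{y' \<in> Y. y' - y \<in> perp} = {}" by (auto simp: represented_def)
      then show ?thesis by (simp only: False card.empty of_bool_eq)
    qed
    finally show ?thesis by simp
  qed
  finally have A2: "A = of_nat n * (of_nat (card C) * of_bool (y \<in> perp)) - of_real r * (of_nat (card C) * of_bool (represented y))"
    by (simp only: E)
  show ?thesis using A1 unfolding A2 by (cases "y \<in> perp"; cases "represented y") (simp_all add: algebra_simps)
qed


text \<open>The weight of the dual word \<open>M *\<^sub>v y\<close>, expressed before any ordering
  of the rows of \<open>M\<close> is fixed.\<close>

definition dual_weight :: "'a vec \<Rightarrow> real" where
  "dual_weight y = (\<Sum>c\<in>C1. hom_weight (c \<bullet> y))"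

lemma dual_weight_nonneg: "dual_weight y \<ge> 0"
  unfolding dual_weight_def by (intro sum_nonneg) (simp add: hom_weight_nonneg[OF frobenius])

lemma zero_perp: "0\<^sub>v n \<in> perp"
  using C_dim by (simp add: perp_def)

lemma Y_perp: "y \<in> Y \<Longrightarrow> y \<notin> perp"
  using Y_nonzero by (auto simp: perp_def)

lemma represented_Y: "y \<in> Y \<Longrightarrow> represented y"
  using zero_perp Y_carrier minus_cancel_vec[of y n] unfolding represented_def by (metis subsetD)

lemma not_represented_zero: "\<not> represented (0\<^sub>v n)"
  using Y_perp Y_carrier minus_zero_vec[of _ n] unfolding represented_def by (metis subsetD)

lemma C1_unit_smult_bij:
  assumes u: "u \<in> ring_units"
  shows "bij_betw (\<lambda>c. u \<cdot>\<^sub>v c) C1 C1"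
proof -
  obtain v where v: "u * v = 1" "v * u = 1" using u by (auto simp: ring_units_def)
  have v_unit: "v \<in> ring_units" using v by (auto simp: ring_units_def)
  have weight: "hom_weight_vec (a \<cdot>\<^sub>v c) = hom_weight_vec c" if "a \<in> ring_units" for a and c :: "'a vec"
    by (simp add: hom_weight_vec_def hom_weight_unit_mult[OF frobenius that])
  show ?thesis
    by (rule bij_betwI[where g = "\<lambda>c. v \<cdot>\<^sub>v c"])
      (use u v v_unit C_smult weight in \<open>auto simp: words_of_weight_def smult_smult_assoc\<close>)
qed

text \<open>\<open>C1\<close> is stable under left multiplication by units, so averaging over the
  units leaves the transform unchanged.\<close>

lemma dual_weight_transform:
  assumes y: "y \<in> carrier_vec n"
  shows "complex_of_real (dual_weight y) = of_nat (card C1) - transform y"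
proof -
  have "complex_of_real (dual_weight y) =
      (\<Sum>c\<in>C1. 1 - (\<Sum>u\<in>ring_units. gen_char (u * (c \<bullet> y))) / of_nat (card (ring_units :: 'a set)))"
    by (simp add: dual_weight_def hom_weight_eq[OF frobenius])
  also have "\<dots> = of_nat (card C1) -
      (\<Sum>c\<in>C1. \<Sum>u\<in>ring_units. gen_char (u * (c \<bullet> y))) / of_nat (card (ring_units :: 'a set))"
    by (simp add: sum_subtractf sum_divide_distrib)
  also have "(\<Sum>c\<in>C1. \<Sum>u\<in>ring_units. gen_char (u * (c \<bullet> y))) = (\<Sum>u\<in>ring_units. \<Sum>c\<in>C1. gen_char (u * (c \<bullet> y)))"
    by (rule sum.swap)
  also have "\<dots> = (\<Sum>u\<in>(ring_units :: 'a set). transform y)"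
  proof (intro sum.cong refl)
    fix u :: 'a assume u: "u \<in> ring_units"
    have "(\<Sum>c\<in>C1. gen_char (u * (c \<bullet> y))) = (\<Sum>c\<in>C1. gen_char ((u \<cdot>\<^sub>v c) \<bullet> y))"
      using C1_subset C_dim y by (intro sum.cong refl) (metis smult_scalar_prod_distrib subsetD)
    also have "\<dots> = transform y"
      unfolding transform_def using C1_unit_smult_bij[OF u] by (rule sum.reindex_bij_betw)
    finally show "(\<Sum>c\<in>C1. gen_char (u * (c \<bullet> y))) = transform y" .
  qed
  finally show ?thesis using card_ring_units_pos[OF frobenius] by (simp add: card_gt_0_iff)
qed

lemma card_C1: "(w2 - w1) * real (card C1) = real (card C) * (w2 - real n) - w2"
proof -
  have "transform (0\<^sub>v n) = (\<Sum>c\<in>C1. 1)"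
    unfolding transform_def using C1_subset C_dim
    by (intro sum.cong refl) (auto simp: gen_char_zero[OF frobenius] subset_iff)
  then have "complex_of_real ((w2 - w1) * real (card C1)) =
      complex_of_real (real (card C) * (w2 - real n) - w2)"
    using transform_eq[OF zero_carrier_vec] zero_perp not_represented_zero by simp
  then show ?thesis by (simp only: of_real_eq_iff)
qed

lemma dual_weight_eq:
  assumes y: "y \<in> carrier_vec n" "y \<notin> perp"
  shows "(w2 - w1) * dual_weight y = real (card C) * (w2 - real n - r * of_bool (represented y))"
proof -
  have "complex_of_real ((w2 - w1) * dual_weight y) = of_real ((w2 - w1) * real (card C1)) - of_real (w2 - w1) * transform y"
    by (simp add: dual_weight_transform[OF y(1)] algebra_simps)
  also have "\<dots> = complex_of_real (real (card C) * (w2 - real n - r * of_bool (represented y)))"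
    unfolding transform_eq[OF y(1)] card_C1 using y(2) by (cases "represented y") (simp_all add: algebra_simps)
  finally show ?thesis by (simp only: of_real_eq_iff)
qed

text \<open>Equivalent to positivity of the smaller dual weight. It also makes the second eigenvalue
  of the dual graph negative, and even less than -1, which is used for
  \<open>second_dual_weight_occurs\<close>.\<close>

lemma weight_gap: "w2 > real n + r"
proof (rule ccontr)
  assume not_gap: "\<not> w2 > real n + r"
  have dual_weight_zero: "dual_weight y = 0" if y: "y \<in> Y" for y
  proof -
    have "(w2 - w1) * dual_weight y = real (card C) * (w2 - real n - r)"
      using dual_weight_eq[OF _ Y_perp[OF y]] Y_carrier y represented_Y[OF y] by auto
    also have "\<dots> \<le> 0" using not_gap by (intro mult_nonneg_nonpos) auto
    finally have "dual_weight y \<le> 0" using weights(1) by (simp add: mult_le_0_iff)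
    with dual_weight_nonneg[of y] show ?thesis by simp
  qed
  obtain c where c: "c \<in> C" "hom_weight_vec c = w1" using word_exists(1) by auto
  have "gen_char (c \<bullet> y) = 1" if "y \<in> Y" for y
  proof (rule gen_char_eq_one_of_hom_weight_zero[OF frobenius])
    have "\<forall>c\<in>C1. hom_weight (c \<bullet> y) = 0"
      using dual_weight_zero[OF that] C1_finite unfolding dual_weight_def
      by (subst (asm) sum_nonneg_eq_0_iff) (auto simp: hom_weight_nonneg[OF frobenius])
    then show "hom_weight (c \<bullet> y) = 0" using c by (simp add: words_of_weight_def)
  qed
  then have "complex_of_real w1 = of_nat n - of_real r * of_nat (card Y)"
    using weight_Y[OF c(1)] c(2) by simp
  also have "\<dots> = complex_of_real (real n - r * real (card Y))" by simp
  also have "\<dots> = 0" by (simp add: length_eq)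
  finally show False using weights_nonzero by simp
qed

text \<open>A vector orthogonal to \<open>C1\<close> has dual weight 0, but outside
  \<open>perp\<close> the dual weight is positive by \<open>weight_gap\<close>. Hence the kernel of
  \<open>M\<close> will be exactly \<open>perp\<close>.\<close>

lemma perp_iff:
  assumes y: "y \<in> carrier_vec n"
  shows "y \<in> perp \<longleftrightarrow> (\<forall>c\<in>C1. c \<bullet> y = 0)"
proof
  assume "\<forall>c\<in>C1. c \<bullet> y = 0"
  then have weight0: "dual_weight y = 0" by (simp add: dual_weight_def hom_weight_zero[OF frobenius])
  show "y \<in> perp"
  proof (rule ccontr)
    assume "y \<notin> perp"
    from dual_weight_eq[OF y this] weight0 card_C_pos have "w2 - real n - r * of_bool (represented y) = 0" by simp
    then show False using weight_gap r_pos by (cases "represented y") auto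
  qed
qed (use C1_subset in \<open>auto simp: perp_def\<close>)

text \<open>Characters of \<open>C\<close> are indexed by all of R^n, with repetitions modulo
  \<open>perp\<close>; no choice of representatives is needed.\<close>

sublocale C_family: character_family n C "carrier_vec n" "\<lambda>c y. gen_char (c \<bullet> y)"
proof
  show "C \<subseteq> carrier_vec n" "0\<^sub>v n \<in> C" by (rule C_carrier, rule C_zero)
  show "u + v \<in> C" if "u \<in> C" "v \<in> C" for u v using that by (rule C_add)
  show "- v \<in> C" if "v \<in> C" for v using that by (rule C_uminus)
  show "finite (carrier_vec n :: 'a vec set)" by (rule finite_carrier_vec)
  show "carrier_vec n \<noteq> ({} :: 'a vec set)" using zero_carrier_vec by blast
  show "gen_char ((u + v) \<bullet> w) = gen_char (u \<bullet> w) * gen_char (v \<bullet> w)"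
    if "u \<in> C" "v \<in> C" "w \<in> carrier_vec n" for u v w
    using add_scalar_prod_distrib[OF C_dim[OF that(1)] C_dim[OF that(2)] that(3)]
    by (simp add: gen_char_add[OF frobenius])
  show "(\<Sum>w\<in>carrier_vec n. gen_char (v \<bullet> w)) = (if v = 0\<^sub>v n then of_nat (card (carrier_vec n :: 'a vec set)) else 0)"
    if v: "v \<in> C" for v
  proof (cases "v = 0\<^sub>v n")
    case True
    then show ?thesis by (simp add: gen_char_zero[OF frobenius])
  next
    case False
    have v_carrier: "v \<in> carrier_vec n" by (rule C_dim[OF v])
    then obtain i where i: "i < n" "v $ i \<noteq> 0" using False by (auto simp: vec_eq_iff)
    then obtain a where a: "gen_char (v $ i * a) \<noteq> 1"
      using generating_character_nondegenerate(2)[OF generating_gen_char[OF frobenius]] by blast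
    \<comment> \<open>A shift supported on one coordinate where \<open>v\<close> is nonzero
      suffices.\<close>
    define z where "z = right_smult_vec (unit_vec n i) a"
    have z: "z \<in> carrier_vec n" by (simp add: z_def right_smult_vec_carrier)
    have "v \<bullet> z = v $ i * a"
      using i v_carrier by (simp add: z_def scalar_prod_right_smult[OF v_carrier unit_vec_carrier] scalar_prod_right_unit)
    with a have z_v: "gen_char (v \<bullet> z) \<noteq> 1" by simp
    have "bij_betw (\<lambda>w. z + w) (carrier_vec n) (carrier_vec n)"
      by (rule bij_betwI[where g = "\<lambda>w. w - z"]) (use z in \<open>auto intro!: eq_vecI\<close>)
    then have "(\<Sum>w\<in>carrier_vec n. gen_char (v \<bullet> w)) = 0"
      by (rule sum_eq_zero_by_shift[OF _ _ z_v])
        (simp add: scalar_prod_add_distrib[OF v_carrier z] gen_char_add[OF frobenius])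
    with False show ?thesis by simp
  qed
qed

text \<open>Vanishing of an eigenvalue reads \<open>r * N = w2\<close>, not yet
  \<open>w1 = n\<close>. The bridge is the degree identity \<open>graph(2)\<close>, a relation
  between the size, length, index and weights of the code.\<close>

lemma trivial_code_graph_iff: "trivial_graph (code_graph C) \<longleftrightarrow> w1 = real n"
proof -
  define d where "d = w2 - w1"
  define N where "N = real (card C)"
  \<comment> \<open>The two values of \<open>transform\<close> outside \<open>perp\<close>, for
    represented vectors and for the others.\<close>
  define \<eta>1 where "\<eta>1 = (r * N - w2) / d"
  define \<eta>2 where "\<eta>2 = - w2 / d"
  define \<mu> where "\<mu> = (real (card C1) - \<eta>1) * (real (card C1) - \<eta>2) / N"
  have d: "d > 0" using weights(1) by (simp add: d_def)
  have N: "N > 0" using card_C_pos by (simp add: N_def)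
  have gap: "w2 - real n - r > 0" using weight_gap by simp
  obtain s0 where s0: "s0 \<in> C1" using word_exists(1) by (auto simp: words_of_weight_def)
  obtain v0 where v0: "v0 \<in> C" "hom_weight_vec v0 = w2" using word_exists(2) by auto
  have v0': "v0 \<notin> C1" "v0 \<noteq> 0\<^sub>v n"
    using v0 weights(1) weights_nonzero weight_zero by (auto simp: words_of_weight_def)
  have spectrum: "\<forall>y\<in>carrier_vec n. (\<exists>c\<in>C. gen_char (c \<bullet> y) \<noteq> 1) \<longrightarrow>
    (\<Sum>c\<in>C1. gen_char (c \<bullet> y)) = of_real \<eta>1 \<or> (\<Sum>c\<in>C1. gen_char (c \<bullet> y)) = of_real \<eta>2"
  proof (intro ballI impI)
    fix y assume y: "y \<in> carrier_vec n" and nontrivial: "\<exists>c\<in>C. gen_char (c \<bullet> y) \<noteq> 1"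
    have "y \<notin> perp"
    proof
      assume "y \<in> perp"
      then have "gen_char (c \<bullet> y) = 1" if "c \<in> C" for c
        using that by (simp add: perp_def gen_char_zero[OF frobenius])
      with nontrivial show False by blast
    qed
    then have "of_real d * transform y = complex_of_real (- w2 + r * N * of_bool (represented y))"
      using transform_eq[OF y] by (simp add: d_def N_def)
    then have "transform y = complex_of_real ((- w2 + r * N * of_bool (represented y)) / d)"
      using d by (simp add: nonzero_eq_divide_eq mult.commute)
    then show "(\<Sum>c\<in>C1. gen_char (c \<bullet> y)) = of_real \<eta>1 \<or> (\<Sum>c\<in>C1. gen_char (c \<bullet> y)) = of_real \<eta>2"
      unfolding transform_def[symmetric] \<eta>1_def \<eta>2_def by (cases "represented y") simp_all
  qed
  note graph = C_family.code_graph_strongly_regular[OF frobenius zero_words, unfolded smaller,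
      OF weights_nonzero(1) s0 v0(1) v0' spectrum, folded N_def, folded \<mu>_def]
  have b1: "real (card C1) = (N * (w2 - real n) - w2) / d"
    using card_C1 d by (simp add: d_def N_def nonzero_eq_divide_eq mult.commute)
  have diffs: "real (card C1) - \<eta>1 = N * (w2 - real n - r) / d" "real (card C1) - \<eta>2 = N * (w2 - real n) / d"
    unfolding b1 \<eta>1_def \<eta>2_def diff_divide_distrib[symmetric] by (simp_all add: algebra_simps)
  have \<mu>: "\<mu> = N * (w2 - real n - r) * (w2 - real n) / d\<^sup>2"
    unfolding \<mu>_def diffs using N by (simp add: power2_eq_square)
  then have "\<mu> \<noteq> 0" using N d gap r_pos by simp
  then have "trivial_graph (code_graph C) \<longleftrightarrow> \<eta>1 * \<eta>2 = 0" by (rule graph(3))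
  also have "\<dots> \<longleftrightarrow> r * N = w2"
    using d weights_nonzero by (simp add: \<eta>1_def \<eta>2_def)
  also have "\<dots> \<longleftrightarrow> w1 = real n"
  proof -
    \<comment> \<open>Under \<open>r * N = w2\<close> the last term vanishes and
      \<open>N * (w2 - n - r)\<close>, nonzero by \<open>weight_gap\<close>, cancels; under
      \<open>w1 = n\<close> everything collapses to \<open>(r * N - w2) * n = 0\<close>.\<close>
    have "(N * (w2 - real n) - w2) / d = N * (w2 - real n - r) * (w2 - real n) / d\<^sup>2 + (r * N - w2) * w2 / d\<^sup>2"
      using graph(2) unfolding \<mu> b1 by (simp add: \<eta>1_def \<eta>2_def power2_eq_square)
    then have eq: "(N * (w2 - real n) - w2) * d = N * (w2 - real n - r) * (w2 - real n) + (r * N - w2) * w2"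
    proof -
      have clear: "x * d = y + z" if "x / d = y / d\<^sup>2 + z / d\<^sup>2" for x y z
      proof -
        have "x / d = (y + z) / d\<^sup>2" using that by (simp add: add_divide_distrib)
        then show ?thesis using d by (simp add: frac_eq_eq power2_eq_square)
      qed
      show ?thesis by (rule clear) fact
    qed
    show ?thesis
    proof
      assume "r * N = w2"
      then have "N * (w2 - real n - r) * (d - (w2 - real n)) = 0"
        using eq by (simp add: algebra_simps)
      then show "w1 = real n" using N gap by (simp add: d_def)
    next
      assume w1: "w1 = real n"
      have "(r * N - w2) * real n = 0"
        using eq unfolding d_def w1 by (auto simp: algebra_simps)
      then show "r * N = w2" using length_pos by simp
    qed
  qed
  finally show ?thesis .
qed

end

section \<open>The dual code and its graph\<close>

locale dual_two_weight = modular_two_weight +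
  fixes M :: "'a mat" and C' :: "'a vec set"
  assumes M: "M \<in> carrier_mat (card C1) n"
    and rows: "bij_betw (row M) {..<card C1} C1"
    and dual: "C' = {M *\<^sub>v y | y. y \<in> carrier_vec n}"
begin

lemma M_mult_carrier: "M *\<^sub>v y \<in> carrier_vec (card C1)"
  using M by (intro carrier_vecI) simp

lemma M_mult_zero_iff:
  assumes y: "y \<in> carrier_vec n"
  shows "M *\<^sub>v y = 0\<^sub>v (card C1) \<longleftrightarrow> y \<in> perp"
proof -
  have "M *\<^sub>v y = 0\<^sub>v (card C1) \<longleftrightarrow> (\<forall>i\<in>{..<card C1}. row M i \<bullet> y = 0)"
    using M by (auto simp: vec_eq_iff)
  also have "\<dots> \<longleftrightarrow> (\<forall>c\<in>row M ` {..<card C1}. c \<bullet> y = 0)" by blast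
  also have "row M ` {..<card C1} = C1" using rows by (simp add: bij_betw_def)
  finally show ?thesis using perp_iff[OF y] by simp
qed

lemma weight_M_mult: "hom_weight_vec (M *\<^sub>v y) = dual_weight y"
proof -
  have "hom_weight_vec (M *\<^sub>v y) = (\<Sum>i<card C1. hom_weight (row M i \<bullet> y))"
    using M by (simp add: hom_weight_vec_def)
  also have "\<dots> = dual_weight y"
    unfolding dual_weight_def using rows by (rule sum.reindex_bij_betw)
  finally show ?thesis .
qed

lemma M_mult_eq_iff:
  assumes y: "y \<in> carrier_vec n" "z \<in> carrier_vec n"
  shows "M *\<^sub>v y = M *\<^sub>v z \<longleftrightarrow> y - z \<in> perp"
proof -
  have "M *\<^sub>v (y - z) = M *\<^sub>v y - M *\<^sub>v z"
    using M y by (rule mult_minus_distrib_mat_vec)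
  moreover have "M *\<^sub>v y = M *\<^sub>v z \<longleftrightarrow> M *\<^sub>v y - M *\<^sub>v z = 0\<^sub>v (card C1)"
    using M by (auto simp: vec_eq_iff)
  moreover have "y - z \<in> carrier_vec n" using y by simp
  ultimately show ?thesis using M_mult_zero_iff by metis
qed

lemma M_mult_eqD:
  assumes "y \<in> carrier_vec n" "z \<in> carrier_vec n" "M *\<^sub>v y = M *\<^sub>v z" and c: "c \<in> C"
  shows "c \<bullet> y = c \<bullet> z"
proof -
  have "c \<bullet> (y - z) = 0"
    using M_mult_eq_iff[OF assms(1,2)] assms(3) c by (simp add: perp_def)
  moreover have "c \<bullet> (y - z) = c \<bullet> y - c \<bullet> z"
    using C_dim[OF c] assms(1,2) by (rule scalar_prod_minus_distrib)
  ultimately show ?thesis by simp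
qed

text \<open>A preimage under \<open>M\<close>, determined only modulo \<open>perp\<close>; by
  \<open>M_mult_eqD\<close> its products with codewords do not depend on the choice.\<close>

definition lift :: "'a vec \<Rightarrow> 'a vec" where
  "lift p = (SOME y. y \<in> carrier_vec n \<and> M *\<^sub>v y = p)"

lemma lift: "p \<in> C' \<Longrightarrow> lift p \<in> carrier_vec n" "p \<in> C' \<Longrightarrow> M *\<^sub>v lift p = p"
proof -
  assume "p \<in> C'"
  then have "\<exists>y. y \<in> carrier_vec n \<and> M *\<^sub>v y = p" unfolding dual by blast
  then have "lift p \<in> carrier_vec n \<and> M *\<^sub>v lift p = p" unfolding lift_def by (rule someI_ex)
  then show "lift p \<in> carrier_vec n" "M *\<^sub>v lift p = p" by simp_all
qed

lemma M_mult_mem: "y \<in> carrier_vec n \<Longrightarrow> M *\<^sub>v y \<in> C'"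
  unfolding dual by blast

lemma lift_M_mult:
  assumes y: "y \<in> carrier_vec n" and c: "c \<in> C"
  shows "c \<bullet> lift (M *\<^sub>v y) = c \<bullet> y"
  using M_mult_eqD[OF lift(1) y lift(2) c] M_mult_mem[OF y] by simp

lemma dual_add: "p \<in> C' \<Longrightarrow> q \<in> C' \<Longrightarrow> p + q = M *\<^sub>v (lift p + lift q)"
  using mult_add_distrib_mat_vec[OF M lift(1) lift(1)] by (simp add: lift(2))

definition W1 :: real where "W1 = real (card C) * (w2 - real n - r) / (w2 - w1)"
definition W2 :: real where "W2 = real (card C) * (w2 - real n) / (w2 - w1)"

lemma W_less: "0 < W1" "W1 < W2"
proof -
  show "0 < W1" unfolding W1_def using weight_gap weights(1) card_C_pos by simp
  show "W1 < W2"
    unfolding W1_def W2_def using r_pos weights(1) card_C_pos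
    by (intro divide_strict_right_mono mult_strict_left_mono) auto
qed

lemma dual_weight_cases:
  assumes y: "y \<in> carrier_vec n"
  shows "dual_weight y = (if y \<in> perp then 0 else if represented y then W1 else W2)"
proof (cases "y \<in> perp")
  case True
  then have "dual_weight y = 0"
    using C1_subset unfolding dual_weight_def
    by (intro sum.neutral) (auto simp: perp_def hom_weight_zero[OF frobenius])
  with True show ?thesis by simp
next
  case False
  have "dual_weight y = real (card C) * (w2 - real n - r * of_bool (represented y)) / (w2 - w1)"
    using dual_weight_eq[OF y False] weights(1) by (simp add: nonzero_eq_divide_eq mult.commute)
  with False show ?thesis by (simp add: W1_def W2_def)
qed

lemma Y_W1: "y \<in> Y \<Longrightarrow> dual_weight y = W1"
  using dual_weight_cases[of y] Y_carrier Y_perp represented_Y by auto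

lemma smaller_dual: "smaller_weight C' = W1"
  unfolding smaller_weight_def
proof (rule Min_eqI)
  have C'_eq: "C' = (\<lambda>y. M *\<^sub>v y) ` carrier_vec n" by (auto simp: dual)
  have "hom_weight_vec ` C' = dual_weight ` carrier_vec n"
    unfolding C'_eq image_image weight_M_mult ..
  then have weights': "nonzero_weights C' = dual_weight ` carrier_vec n - {0}"
    by (simp add: nonzero_weights_def)
  show "finite (nonzero_weights C')" by (simp add: weights' finite_carrier_vec)
  show "W1 \<le> w" if "w \<in> nonzero_weights C'" for w
    using that W_less by (auto simp: weights' dual_weight_cases)
  obtain y where "y \<in> Y" using Y_nonempty by auto
  then show "W1 \<in> nonzero_weights C'"
    unfolding weights' using Y_W1 Y_carrier W_less(1) by force
qed

lemma dual_zero_words: "words_of_weight C' 0 = {0\<^sub>v (card C1)}"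
proof (intro equalityI subsetI)
  fix p assume "p \<in> words_of_weight C' 0"
  then obtain y where y: "y \<in> carrier_vec n" "p = M *\<^sub>v y" "dual_weight y = 0"
    by (auto simp: words_of_weight_def dual weight_M_mult)
  then have "y \<in> perp" using dual_weight_cases[OF y(1)] W_less by (auto split: if_splits)
  then show "p \<in> {0\<^sub>v (card C1)}" using M_mult_zero_iff[OF y(1)] y(2) by simp
next
  fix p assume "p \<in> {0\<^sub>v (card C1) :: 'a vec}"
  then have p: "p = M *\<^sub>v 0\<^sub>v n" using M_mult_zero_iff[OF zero_carrier_vec] zero_perp by simp
  have "dual_weight (0\<^sub>v n) = 0" using dual_weight_cases[OF zero_carrier_vec] zero_perp by simp
  then show "p \<in> words_of_weight C' 0"
    unfolding p words_of_weight_def by (simp add: weight_M_mult M_mult_mem)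
qed

abbreviation S where "S \<equiv> words_of_weight C' W1"

text \<open>As \<open>W1\<close> differs from 0 and \<open>W2\<close>, a word of weight
  \<open>W1\<close> comes from a represented vector, which may be replaced modulo
  \<open>perp\<close> by a member of \<open>Y\<close>.\<close>

lemma S_eq: "S = (\<lambda>y. M *\<^sub>v y) ` Y"
proof (intro equalityI subsetI)
  fix p assume "p \<in> S"
  then obtain y where y: "y \<in> carrier_vec n" "p = M *\<^sub>v y" "dual_weight y = W1"
    by (auto simp: words_of_weight_def dual weight_M_mult)
  then have "represented y" using dual_weight_cases[OF y(1)] W_less by (auto split: if_splits)
  then obtain y' where y': "y' \<in> Y" "y' - y \<in> perp" by (auto simp: represented_def)
  have "y' \<in> carrier_vec n" using y'(1) Y_carrier by auto
  then have "M *\<^sub>v y' = M *\<^sub>v y" using M_mult_eq_iff[of y' y] y(1) y'(2) by simp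
  then have "p = M *\<^sub>v y'" by (simp only: y(2))
  then show "p \<in> (\<lambda>y. M *\<^sub>v y) ` Y" using y'(1) by (rule image_eqI)
next
  fix p assume "p \<in> (\<lambda>y. M *\<^sub>v y) ` Y"
  then obtain y where y: "y \<in> Y" "p = M *\<^sub>v y" by auto
  then have "y \<in> carrier_vec n" using Y_carrier by auto
  then show "p \<in> S" using Y_W1[OF y(1)] unfolding y(2)
    by (simp add: words_of_weight_def weight_M_mult M_mult_mem)
qed

lemma M_inj_Y: "inj_on (\<lambda>y. M *\<^sub>v y) Y"
proof (rule inj_onI)
  fix y z assume yz: "y \<in> Y" "z \<in> Y" "M *\<^sub>v y = M *\<^sub>v z"
  then have carrier: "y \<in> carrier_vec n" "z \<in> carrier_vec n" using Y_carrier by auto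
  show "y = z"
    using yz(1,2) by (rule Y_distinct) (use M_mult_eqD[OF carrier yz(3)] in blast)
qed

lemma card_S: "real (card S) = real n / r"
  unfolding S_eq using card_image[OF M_inj_Y] length_eq r_pos by (simp add: nonzero_eq_divide_eq mult.commute)

lemma S_sum:
  assumes c: "c \<in> C"
  shows "(\<Sum>p\<in>S. gen_char (c \<bullet> lift p)) = complex_of_real ((real n - hom_weight_vec c) / r)"
proof -
  have "(\<Sum>p\<in>S. gen_char (c \<bullet> lift p)) = (\<Sum>y\<in>Y. gen_char (c \<bullet> lift (M *\<^sub>v y)))"
    unfolding S_eq by (rule sum.reindex[OF M_inj_Y, unfolded o_def])
  also have "\<dots> = (\<Sum>y\<in>Y. gen_char (c \<bullet> y))"
    using lift_M_mult[OF _ c] Y_carrier by (intro sum.cong refl) (simp add: subset_iff)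
  finally show ?thesis
    using weight_Y[OF c] r_pos by (simp add: nonzero_eq_divide_eq algebra_simps)
qed

text \<open>The roles are exchanged: codewords now index the characters, and the orthogonality
  relation is \<open>character_sum\<close>.\<close>

sublocale dual_family: character_family "card C1" C' C "\<lambda>p c. gen_char (c \<bullet> lift p)"
proof
  show "C' \<subseteq> carrier_vec (card C1)" unfolding dual using M_mult_carrier by blast
  show "0\<^sub>v (card C1) \<in> C'" using dual_zero_words by (auto simp: words_of_weight_def)
  show "u + v \<in> C'" if "u \<in> C'" "v \<in> C'" for u v
    using that by (simp add: dual_add M_mult_mem lift(1))
  show "- v \<in> C'" if v: "v \<in> C'" for v
  proof -
    have "M *\<^sub>v (- z) = - (M *\<^sub>v z)" if "z \<in> carrier_vec n" for z
      using M that by (intro eq_vecI) auto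
    from this[OF lift(1)[OF v]] have "- v = M *\<^sub>v (- lift v)"
      by (simp only: lift(2)[OF v])
    then show ?thesis using lift(1)[OF v] M_mult_mem[of "- lift v"] by simp
  qed
  show "finite C" "C \<noteq> {}" using C_finite C_zero by auto
  show "gen_char (w \<bullet> lift (u + v)) = gen_char (w \<bullet> lift u) * gen_char (w \<bullet> lift v)"
    if "u \<in> C'" "v \<in> C'" "w \<in> C" for u v w
  proof -
    have "w \<bullet> lift (u + v) = w \<bullet> (lift u + lift v)"
      using that by (simp add: dual_add lift_M_mult lift(1))
    also have "\<dots> = w \<bullet> lift u + w \<bullet> lift v"
      using C_dim[OF that(3)] lift(1) that by (intro scalar_prod_add_distrib) auto
    finally show ?thesis by (simp add: gen_char_add[OF frobenius])
  qed
  show "(\<Sum>w\<in>C. gen_char (w \<bullet> lift v)) = (if v = 0\<^sub>v (card C1) then of_nat (card C) else 0)" if "v \<in> C'" for v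
    using character_sum[OF lift(1)[OF that]] M_mult_zero_iff[OF lift(1)[OF that]] lift(2)[OF that] by simp
qed

text \<open>A codeword whose character is 1 on \<open>S\<close> attains the full sum
  \<open>n / r\<close> there, so its weight is 0 by \<open>S_sum\<close>.\<close>

lemma dual_character_trivial:
  assumes c: "c \<in> C" and trivial: "\<forall>p\<in>C'. gen_char (c \<bullet> lift p) = 1"
  shows "c = 0\<^sub>v n"
proof -
  have "(\<Sum>p\<in>S. gen_char (c \<bullet> lift p)) = (\<Sum>p\<in>S. 1)"
    using trivial by (intro sum.cong refl) (simp add: words_of_weight_def)
  also have "\<dots> = complex_of_real (real n / r)" by (simp flip: card_S)
  finally have "(real n - hom_weight_vec c) / r = real n / r"
    by (simp only: S_sum[OF c] of_real_eq_iff)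
  then have "hom_weight_vec c = 0" using r_pos by (simp add: field_simps)
  then show ?thesis using weight_cases[OF c] weights_nonzero by auto
qed

lemma card_dual: "card C' = card C"
proof -
  have "gen_char (0\<^sub>v n \<bullet> lift p) = 1" if "p \<in> C'" for p
    using lift(1)[OF that] by (simp add: gen_char_zero[OF frobenius])
  then have "{c \<in> C. \<forall>p\<in>C'. gen_char (c \<bullet> lift p) = 1} = {0\<^sub>v n}"
    using dual_character_trivial C_zero by blast
  then show ?thesis using dual_family.\<beta>_trivial_character_count by simp
qed

text \<open>Otherwise a nontrivial character of \<open>C'\<close> would sum to \<open>1 + (n - w2) / r < 0\<close>.\<close>

lemma second_dual_weight_occurs: "\<exists>v\<in>C'. v \<notin> S \<and> v \<noteq> 0\<^sub>v (card C1)"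
proof (rule ccontr)
  assume "\<not> ?thesis"
  then have C'_eq: "C' = insert (0\<^sub>v (card C1)) S"
    using dual_family.V_zero by (auto simp: words_of_weight_def)
  have "hom_weight_vec (0\<^sub>v (card C1) :: 'a vec) = 0"
    by (simp add: hom_weight_vec_def hom_weight_zero[OF frobenius])
  then have zero_S: "0\<^sub>v (card C1) \<notin> S"
    using W_less(1) by (simp add: words_of_weight_def[of C'])
  obtain c where c: "c \<in> C" "hom_weight_vec c = w2" using word_exists(2) by auto
  have "c \<noteq> 0\<^sub>v n" using c weight_zero weights_nonzero by auto
  then have "(\<Sum>p\<in>C'. gen_char (c \<bullet> lift p)) = 0"
    using dual_family.\<beta>_sum[OF c(1)] dual_character_trivial[OF c(1)] by auto
  moreover have "(\<Sum>p\<in>C'. gen_char (c \<bullet> lift p)) =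
      gen_char (c \<bullet> lift (0\<^sub>v (card C1))) + (\<Sum>p\<in>S. gen_char (c \<bullet> lift p))"
    using zero_S dual_family.V_finite by (subst C'_eq) (simp add: words_of_weight_def)
  moreover have "lift (0\<^sub>v (card C1)) \<in> perp"
    using M_mult_zero_iff lift dual_family.V_zero by blast
  then have "gen_char (c \<bullet> lift (0\<^sub>v (card C1))) = 1"
    using c by (simp add: perp_def gen_char_zero[OF frobenius])
  ultimately have "complex_of_real (1 + (real n - w2) / r) = 0"
    by (simp add: S_sum[OF c(1)] c(2))
  then have "1 + (real n - w2) / r = 0" by (simp only: of_real_eq_0_iff)
  then have "r + real n = w2" using r_pos by (simp add: field_simps)
  with weight_gap show False by simp
qed

lemma dual_graph:
  "\<exists>l m. strongly_regular (code_graph C') (card C) (card S) l m \<and>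
     real l = (2 * real n - w1 - w2) / r + w1 * w2 / (r\<^sup>2 * real (card C)) \<and>
     real m = w1 * w2 / (r\<^sup>2 * real (card C))"
  "trivial_graph (code_graph C') \<longleftrightarrow> w1 = real n"
proof -
  define \<theta>1 where "\<theta>1 = (real n - w1) / r"
  define \<theta>2 where "\<theta>2 = (real n - w2) / r"
  define \<mu> where "\<mu> = (real (card S) - \<theta>1) * (real (card S) - \<theta>2) / real (card C)"
  obtain v0 where v0: "v0 \<in> C'" "v0 \<notin> S" "v0 \<noteq> 0\<^sub>v (card C1)"
    using second_dual_weight_occurs by auto
  obtain s0 where s0: "s0 \<in> S" using S_eq Y_nonempty by auto
  have spectrum: "\<forall>c\<in>C. (\<exists>p\<in>C'. gen_char (c \<bullet> lift p) \<noteq> 1) \<longrightarrow>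
    (\<Sum>p\<in>S. gen_char (c \<bullet> lift p)) = of_real \<theta>1 \<or> (\<Sum>p\<in>S. gen_char (c \<bullet> lift p)) = of_real \<theta>2"
  proof (intro ballI impI)
    fix c assume c: "c \<in> C" and nontrivial: "\<exists>p\<in>C'. gen_char (c \<bullet> lift p) \<noteq> 1"
    have "c \<noteq> 0\<^sub>v n"
    proof
      assume "c = 0\<^sub>v n"
      then have "gen_char (c \<bullet> lift p) = 1" if "p \<in> C'" for p
        using lift(1)[OF that] by (simp add: gen_char_zero[OF frobenius])
      with nontrivial show False by blast
    qed
    then show "(\<Sum>p\<in>S. gen_char (c \<bullet> lift p)) = of_real \<theta>1 \<or> (\<Sum>p\<in>S. gen_char (c \<bullet> lift p)) = of_real \<theta>2"
      using weight_cases[OF c] S_sum[OF c] unfolding \<theta>1_def \<theta>2_def by auto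
  qed
  have W1_nonzero: "W1 \<noteq> 0" using W_less(1) by simp
  note graph = dual_family.code_graph_strongly_regular[OF frobenius dual_zero_words, unfolded smaller_dual card_dual,
      OF W1_nonzero s0 v0 spectrum, folded \<mu>_def]
  \<comment> \<open>The degree \<open>n / r\<close> exceeds the two eigenvalues by
    \<open>w1 / r\<close> and \<open>w2 / r\<close>.\<close>
  have \<mu>: "\<mu> = w1 * w2 / (r\<^sup>2 * real (card C))"
    unfolding \<mu>_def card_S \<theta>1_def \<theta>2_def diff_divide_distrib[symmetric]
    by (simp add: power2_eq_square)
  have "\<theta>1 + \<theta>2 = (2 * real n - w1 - w2) / r"
    by (simp add: \<theta>1_def \<theta>2_def add_divide_distrib[symmetric])
  then show "\<exists>l m. strongly_regular (code_graph C') (card C) (card S) l m \<and>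
     real l = (2 * real n - w1 - w2) / r + w1 * w2 / (r\<^sup>2 * real (card C)) \<and>
     real m = w1 * w2 / (r\<^sup>2 * real (card C))"
    using graph(1) unfolding \<mu> by simp
  have "\<mu> \<noteq> 0" unfolding \<mu> using weights_nonzero r_pos card_C_pos by simp
  then have "trivial_graph (code_graph C') \<longleftrightarrow> \<theta>1 * \<theta>2 = 0" by (rule graph(3))
  \<comment> \<open>\<open>weight_gap\<close> makes \<open>\<theta>2\<close> negative, so only
    \<open>\<theta>1\<close> can vanish.\<close>
  also have "\<dots> \<longleftrightarrow> w1 = real n"
    using r_pos weight_gap by (auto simp: \<theta>1_def \<theta>2_def)
  finally show "trivial_graph (code_graph C') \<longleftrightarrow> w1 = real n" .
qed

end

theorem theorem16:
  fixes C C' :: "'a::{ring_1,finite} vec set" and n :: nat and r w1 w2 :: real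
  assumes "frobenius_ring TYPE('a)"
    and "left_linear_code n C"
    and "modular_code n C r"
    and "two_weight_code n C w1 w2"
    and "words_of_weight C 0 = {0\<^sub>v n}"
    and "is_dual_code n C C'"
  shows "(\<exists>N' K' l' m'. strongly_regular (code_graph C') N' K' l' m' \<and>
            N' = card C \<and>
            real K' = real n / r \<and>
            real l' = (2 * real n - w1 - w2) / r + w1 * w2 / (r\<^sup>2 * real (card C)) \<and>
            real m' = w1 * w2 / (r\<^sup>2 * real (card C))) \<and>
         (trivial_graph (code_graph C') \<longleftrightarrow> w1 = real n) \<and>
         (trivial_graph (code_graph C) \<longleftrightarrow> w1 = real n)"
proof -
  obtain Y where Y: "Y \<subseteq> carrier_vec n" "\<forall>y\<in>Y. \<exists>c\<in>C. c \<bullet> y \<noteq> 0"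
    "\<forall>y\<in>Y. \<forall>y'\<in>Y. (\<forall>c\<in>C. c \<bullet> y = c \<bullet> y') \<longrightarrow> y = y'"
    "\<forall>c\<in>C. complex_of_real (hom_weight_vec c) = of_nat n - of_real r * (\<Sum>y\<in>Y. gen_char (c \<bullet> y))"
    using modular_code_characters[OF assms(1,3)] by blast
  interpret modular_two_weight n C r w1 w2 Y
    using assms(1,2,4,5) Y by unfold_locales (auto simp: two_weight_code_def)
  obtain M where M: "M \<in> carrier_mat (card C1) n" "bij_betw (row M) {..<card C1} C1"
    "C' = right_span (card C1) (set (cols M))"
    using assms(6) unfolding is_dual_code_def smaller Let_def by blast
  interpret dual_two_weight n C r w1 w2 Y M C'
    by unfold_locales (simp_all add: M right_span_cols[OF M(1)])
  show ?thesis
    using dual_graph card_S trivial_code_graph_iff by blast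
qed

end
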